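(* Let $A:\mathbb{R}\to\mathbb{C}$ be a function from the class $C$, let $\gamma\in\mathbb{R}$ and let $h\in W_0$. Consider the function $g(x)=A(x)|x|^{\gamma}+h(x)$ on $\mathbb{R}$. Then for any $c>0$ the set of $\alpha>0$ such that $\left(\alpha,\frac{c}{\alpha}\right)$ belongs to the frame set $\mathcal{F}_g$ is open.
   Context: Class $C$: a continuous function $A:\mathbb{R}\to\mathbb{C}$ belongs to the class $C$ if there exist constants $0<\delta<\Delta$ and $A_1,A_2\in\mathbb{R}$ such that $A(x)=0$ for $|x|<\delta$, $A(x)=A_1$ for $x<-\Delta$, and $A(x)=A_2$ for $x>\Delta$. The product $A(x)|x|^\gamma$ is understood to be $0$ at $x=0$ (it vanishes for $|x|<\delta$). Wiener algebra: a measurable function $f:\mathbb{R}\to\mathbb{C}$ belongs to the Wiener algebra $W$ if $\|f\|_W=\sum_{n\in\mathbb{Z}}\operatorname{ess\,sup}_{n<x<n+1}|f(x)|<\infty$. The continuous Wiener algebra is $W_0=W\cap C(\mathbb{R})$, where $C(\mathbb{R})$ is the space of continuous functions $\mathbb{R}\to\mathbb{C}$. Frame set: for $\alpha,\beta>0$ and $g\in L^2(\mathbb{R})$ let $\mathcal{G}(g;\alpha,\beta)=\{g_{n,m}\}_{n,m\in\mathbb{Z}}$, where $g_{n,m}(x)=g(x-n\alpha)e^{2\pi i m\beta x}$. The system $\mathcal{G}(g;\alpha,\beta)$ is a frame if there exist constants $A',B'>0$ such that for all $f\in L^2(\mathbb{R})$ $$A'\|f\|^2\le\sum_{n,m\in\mathbb{Z}}|\langle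 f,g_{n,m}\rangle|^2\le B'\|f\|^2,$$ where $\|\cdot\|$ is the $L^2(\mathbb{R})$ norm and $\langle f,g_{n,m}\rangle=\int_{\mathbb{R}}f(x)\overline{g_{n,m}(x)}\,dx$. The frame set $\mathcal{F}_g$ is the set of all pairs $(\alpha,\beta)$ with $\alpha,\beta>0$ such that $\mathcal{G}(g;\alpha,\beta)$ is a frame. When $g\notin L^2(\mathbb{R})$ (which may happen for $\gamma\ge-\frac12$), the frame inequality is required only for all Schwartz functions $f$, with the same integral defining $\langle f,g_{n,m}\rangle$. *)

theory Defs
  imports "HOL-Analysis.Analysis" "HOL-Probability.Essential_Supremum"
begin

definition class_C :: "(real \<Rightarrow> complex) \<Rightarrow> bool" where
  "class_C A \<longleftrightarrow> continuous_on UNIV A \<and>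
     (\<exists>\<delta> \<Delta> A\<^sub>1 A\<^sub>2 :: real. 0 < \<delta> \<and> \<delta> < \<Delta> \<and>
        (\<forall>x. \<bar>x\<bar> < \<delta> \<longrightarrow> A x = 0) \<and>
        (\<forall>x. x < - \<Delta> \<longrightarrow> A x = of_real A\<^sub>1) \<and>
        (\<forall>x. x > \<Delta> \<longrightarrow> A x = of_real A\<^sub>2))"

definition wiener_norm :: "(real \<Rightarrow> complex) \<Rightarrow> ennreal" where
  "wiener_norm f = (\<Sum>\<^sub>\<infinity>n\<in>(UNIV :: int set).
     esssup (restrict_space lebesgue {real_of_int n<..<real_of_int n + 1}) (\<lambda>x. ennreal (cmod (f x))))"

definition wiener_W :: "(real \<Rightarrow> complex) set" where
  "wiener_W = {f. f \<in> borel_measurable lebesgue \<and> wiener_norm f < \<infinity>}"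

definition wiener_W0 :: "(real \<Rightarrow> complex) set" where
  "wiener_W0 = wiener_W \<inter> {f. continuous_on UNIV f}"

definition L2 :: "(real \<Rightarrow> complex) set" where
  "L2 = {f. f \<in> borel_measurable lebesgue \<and> integrable lebesgue (\<lambda>x. (cmod (f x))\<^sup>2)}"

definition L2_norm :: "(real \<Rightarrow> complex) \<Rightarrow> real" where
  "L2_norm f = sqrt (LINT x|lebesgue. (cmod (f x))\<^sup>2)"

definition L2_inner :: "(real \<Rightarrow> complex) \<Rightarrow> (real \<Rightarrow> complex) \<Rightarrow> complex" where
  "L2_inner f g = (LINT x|lebesgue. f x * cnj (g x))"

definition higher_vderiv :: "nat \<Rightarrow> (real \<Rightarrow> complex) \<Rightarrow> real \<Rightarrow> complex" where
  "higher_vderiv k f = ((\<lambda>u x. vector_derivative u (at x)) ^^ k) f"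

definition schwartz :: "(real \<Rightarrow> complex) set" where
  "schwartz = {f. \<forall>k. (\<forall>x. higher_vderiv k f differentiable at x) \<and>
     (\<forall>j::nat. bounded (range (\<lambda>x. of_real (x ^ j) * higher_vderiv k f x)))}"

definition gabor_atom :: "(real \<Rightarrow> complex) \<Rightarrow> real \<Rightarrow> real \<Rightarrow> int \<Rightarrow> int \<Rightarrow> real \<Rightarrow> complex" where
  "gabor_atom g \<alpha> \<beta> n m x = g (x - of_int n * \<alpha>) * cis (2 * pi * of_int m * \<beta> * x)"

text \<open>The sums are taken in the extended nonnegative reals, so they always exist and the
  upper inequality includes their finiteness.\<close>

definition frame_bounds_on ::
    "(real \<Rightarrow> complex) set \<Rightarrow> (real \<Rightarrow> complex) \<Rightarrow> real \<Rightarrow> real \<Rightarrow> bool" where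
  "frame_bounds_on F g \<alpha> \<beta> \<longleftrightarrow> (\<exists>A' B' :: real. A' > 0 \<and> B' > 0 \<and> (\<forall>f\<in>F.
     ennreal (A' * (L2_norm f)\<^sup>2)
       \<le> (\<Sum>\<^sub>\<infinity>(n, m)\<in>UNIV. ennreal ((cmod (L2_inner f (gabor_atom g \<alpha> \<beta> n m)))\<^sup>2)) \<and>
     (\<Sum>\<^sub>\<infinity>(n, m)\<in>UNIV. ennreal ((cmod (L2_inner f (gabor_atom g \<alpha> \<beta> n m)))\<^sup>2))
       \<le> ennreal (B' * (L2_norm f)\<^sup>2)))"

text \<open>For windows outside \<open>L\<^sup>2\<close> the inequality is tested on Schwartz functions only. This is
  meaningful when the window is locally bounded with at most polynomial growth, so that the
  integrals defining the inner products converge; otherwise a divergent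
  integral takes the default value 0.\<close>

definition gabor_frame :: "(real \<Rightarrow> complex) \<Rightarrow> real \<Rightarrow> real \<Rightarrow> bool" where
  "gabor_frame g \<alpha> \<beta> \<longleftrightarrow> frame_bounds_on (if g \<in> L2 then L2 else schwartz) g \<alpha> \<beta>"

definition frame_set :: "(real \<Rightarrow> complex) \<Rightarrow> (real \<times> real) set" where
  "frame_set g = {(\<alpha>, \<beta>). \<alpha> > 0 \<and> \<beta> > 0 \<and> gabor_frame g \<alpha> \<beta>}"

end

theory Submission
  imports Defs "HOL-Probability.Sinc_Integral"
begin

text \<open>
  Openness holds because of three facts. First, along the hyperbola \<open>\<alpha> \<beta> = c\<close> a change of the lattice
  can be traded for a dilation of the window: with \<open>r = \<alpha> / \<alpha>0\<close>, the substitution \<open>x = r y\<close> turns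
  the coefficients of \<open>f\<close> for \<open>g\<close> and \<open>(\<alpha>, c / \<alpha>)\<close> into those of \<open>f (r y)\<close> for \<open>g (r y)\<close> and the
  fixed lattice \<open>(\<alpha>0, c / \<alpha>0)\<close> (lemma \<open>L2_inner_gabor_atom_dilation\<close>). A frame may moreover
  be multiplied by the constant \<open>r powr - \<gamma>\<close>.

  Second, the rescaled window \<open>r powr - \<gamma> * g (r y)\<close> tends to \<open>g\<close> in the Wiener algebra as \<open>r\<close> tends to 1,
  even if \<open>g\<close> itself is not in that algebra. The term \<open>A x * \<bar>x\<bar> powr \<gamma>\<close> is homogeneous of degree \<open>\<gamma>\<close>
  outside a compact set, so its rescaling differs from it only on a compact set, and there uniformly
  little. For \<open>h\<close> one splits off a tail that is small in the Wiener norm, and treats the rest like a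
  function of compact support.

  Third, a window in the Wiener algebra has a Bessel bound controlled by the square of its Wiener norm
  (lemma \<open>gabor_bessel_amalgam\<close>). So the coefficients of the difference of the two windows are
  square summable with a constant as small as desired, and such a perturbation does not destroy frame
  bounds (lemma \<open>frame_inequality_perturbation\<close>). The second and third fact are combined in lemma
  \<open>gabor_bessel_rescaled_window_difference\<close>.

  The test functions are all of \<open>L2\<close> or the Schwartz functions, depending on \<open>g\<close> only. Both classes
  lie in \<open>L2\<close>, are invariant under dilation, and pair absolutely convergently with the atoms of
  \<open>g\<close>; this is all that the argument needs to know about them.
\<close>

section \<open>Bessel inequality for exponentials\<close>

lemma cis_integral_over_period:
  fixes T a :: real and k :: int
  assumes "T > 0" "k \<noteq> 0"
  shows "(LINT x|lebesgue. indicator {a..<a+T} x *\<^sub>R cis (2 * pi * of_int k * x / T)) = 0"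
proof -
  define w where "w = 2 * pi * of_int k / T"
  have "w \<noteq> 0" using assms by (simp add: w_def)
  have per: "cis (w * (a + T)) = cis (w * a)"
    using assms by (simp add: w_def distrib_left cis_mult[symmetric])
  have "((\<lambda>x. cis (w * x)) has_integral (cis (w * (a+T)) / (\<i> * w) - cis (w * a) / (\<i> * w))) {a..a+T}"
  proof (rule fundamental_theorem_of_calculus)
    fix x assume "x \<in> {a..a+T}"
    show "((\<lambda>x. cis (w * x) / (\<i> * w)) has_vector_derivative cis (w * x)) (at x within {a..a + T})"
    proof -
      have "((\<lambda>z. exp (\<i> * of_real w * z) / (\<i> * of_real w)) has_field_derivative
               exp (\<i> * of_real w * of_real x)) (at (of_real x))"
        using \<open>w \<noteq> 0\<close> by (auto intro!: derivative_eq_intros)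
      from has_vector_derivative_real_field[OF this] show ?thesis
        by (simp add: cis_conv_exp mult.assoc)
    qed
  qed (use assms in auto)
  then have i0: "integral {a..a+T} (\<lambda>x. cis (w * x)) = 0"
    unfolding per by (simp add: integral_unique)
  have "set_integrable lebesgue {a..a+T} (\<lambda>x. cis (w * x))"
    by (intro absolutely_integrable_continuous_real continuous_intros)
  then have "(LINT x|lebesgue. indicator {a..a+T} x *\<^sub>R cis (w * x)) = 0"
    using i0 by (simp add: set_lebesgue_integral_eq_integral(2)[symmetric] set_lebesgue_integral_def)
  moreover have "(LINT x|lebesgue. indicator {a..<a+T} x *\<^sub>R cis (w * x))
     = (LINT x|lebesgue. indicator {a..a+T} x *\<^sub>R cis (w * x))"
  proof (rule integral_cong_AE)
    have "AE x in lebesgue. x \<notin> {a+T}"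
      by (intro AE_not_in) (simp add: null_sets_def)
    then show "AE x in lebesgue. indicat_real {a..<a+T} x *\<^sub>R cis (w * x) = indicator {a..a+T} x *\<^sub>R cis (w * x)"
      by eventually_elim (auto simp: indicator_def)
  qed (auto intro!: borel_measurable_scaleR measurable_completion borel_measurable_continuous_onI continuous_intros)
  ultimately show ?thesis by (simp add: w_def field_simps)
qed

lemma borel_measurable_cnj:
  assumes "f \<in> borel_measurable M"
  shows "(\<lambda>x. cnj (f x)) \<in> borel_measurable M"
  by (rule measurable_compose[OF assms]) (intro borel_measurable_continuous_onI continuous_intros)

text \<open>
  Subtract from \<open>F\<close> its orthogonal projection \<open>G\<close> onto the span of the chosen exponentials on one
  period; the claim is \<open>0 \<le> \<integral>\<bar>F - G\<bar>\<^sup>2 = \<integral>\<bar>F\<bar>\<^sup>2 - T \<Sum>\<bar>c m\<bar>\<^sup>2\<close>.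
\<close>

lemma bessel_inequality_exponentials:
  fixes F :: "real \<Rightarrow> complex" and T a :: real and M :: "int set"
  assumes T: "T > 0" and M: "finite M"
    and F: "integrable lebesgue F" "integrable lebesgue (\<lambda>x. (cmod (F x))\<^sup>2)"
    and supp: "\<And>x. x \<notin> {a..<a+T} \<Longrightarrow> F x = 0"
  shows "(\<Sum>m\<in>M. (cmod (LINT x|lebesgue. F x * cnj (cis (2 * pi * of_int m * x / T))))\<^sup>2)
           \<le> T * (LINT x|lebesgue. (cmod (F x))\<^sup>2)"
proof -
  define I where "I = {a..<a+T}"
  define e where "e m x = cis (2 * pi * of_int m * x / T)" for m :: int and x
  define c where "c m = (LINT x|lebesgue. F x * cnj (e m x)) / T" for m
  define G where "G x = indicator I x *\<^sub>R (\<Sum>m\<in>M. c m * e m x)" for x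
  have e_meas: "e m \<in> borel_measurable lebesgue" for m
    unfolding e_def by (auto intro!: measurable_completion borel_measurable_continuous_onI continuous_intros simp: T less_imp_neq[OF T, symmetric])
  have e_norm: "cmod (e m x) = 1" for m x by (simp add: e_def)
  have Fe: "integrable lebesgue (\<lambda>x. F x * cnj (e m x))" for m
    by (rule Bochner_Integration.integrable_bound[OF F(1)])
       (use e_meas F(1) in \<open>auto simp: norm_mult e_norm intro!: borel_measurable_times borel_measurable_cnj\<close>)
  have I_fin: "integrable lebesgue (\<lambda>x. indicator I x *\<^sub>R (1::complex))"
    unfolding I_def using T by (intro integrable_real_indicator integrable_scaleR_left) auto
  have eI: "integrable lebesgue (\<lambda>x. indicator I x *\<^sub>R (e m x * cnj (e m' x)))" for m m'
    by (rule Bochner_Integration.integrable_bound[OF I_fin])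
       (use e_meas in \<open>auto simp: norm_mult e_norm I_def intro!: borel_measurable_indicator borel_measurable_scaleR borel_measurable_times borel_measurable_cnj\<close>)
  have ortho: "(LINT x|lebesgue. indicator I x *\<^sub>R (e m x * cnj (e m' x))) = (if m = m' then of_real T else 0)" for m m'
  proof -
    have *: "e m x * cnj (e m' x) = cis (2 * pi * of_int (m - m') * x / T)" for x
      by (simp add: e_def cis_cnj cis_mult ring_distribs diff_divide_distrib left_diff_distrib right_diff_distrib)
    show ?thesis
    proof (cases "m = m'")
      case True
      have "(LINT x|lebesgue. indicator I x *\<^sub>R (1::complex)) = of_real T"
        unfolding I_def using T by (simp add: scaleR_conv_of_real del: of_real_indicator)
      then show ?thesis unfolding * using True by simp
    next
      case False
      then show ?thesis unfolding * I_def using cis_integral_over_period[OF T, of "m - m'" a] by simp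
    qed
  qed
  have G_exp: "F x * cnj (G x) = (\<Sum>m\<in>M. cnj (c m) * (F x * cnj (e m x)))" for x
    using supp[of x] by (auto simp: G_def I_def indicator_def sum_distrib_left mult_ac)
  have FG: "integrable lebesgue (\<lambda>x. F x * cnj (G x))"
    unfolding G_exp using Fe by (intro Bochner_Integration.integrable_sum integrable_mult_right) auto
  have FG_val: "(LINT x|lebesgue. F x * cnj (G x)) = T * (\<Sum>m\<in>M. (cmod (c m))\<^sup>2)"
  proof -
    have "(LINT x|lebesgue. F x * cnj (G x)) = (\<Sum>m\<in>M. cnj (c m) * (LINT x|lebesgue. F x * cnj (e m x)))"
      unfolding G_exp using Fe by (subst Bochner_Integration.integral_sum) auto
    also have "\<dots> = (\<Sum>m\<in>M. T * (c m * cnj (c m)))"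
      using T by (intro sum.cong) (auto simp: c_def)
    finally show ?thesis by (simp add: complex_norm_square sum_distrib_left del: of_real_power)
  qed
  have GG_exp: "G x * cnj (G x) = (\<Sum>m\<in>M. \<Sum>m'\<in>M. (c m * cnj (c m')) * (indicator I x *\<^sub>R (e m x * cnj (e m' x))))" for x
    by (auto simp: G_def indicator_def sum_product mult_ac)
  have ceI: "integrable lebesgue (\<lambda>x. (c m * cnj (c m')) * (indicator I x *\<^sub>R (e m x * cnj (e m' x))))" for m m'
    by (intro integrable_mult_right eI)
  have ceI_sum: "integrable lebesgue (\<lambda>x. \<Sum>m'\<in>M. (c m * cnj (c m')) * (indicator I x *\<^sub>R (e m x * cnj (e m' x))))" for m
    by (intro Bochner_Integration.integrable_sum ceI)
  have GG: "integrable lebesgue (\<lambda>x. G x * cnj (G x))"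
    unfolding GG_exp by (intro Bochner_Integration.integrable_sum ceI)
  have GG_val: "(LINT x|lebesgue. G x * cnj (G x)) = T * (\<Sum>m\<in>M. (cmod (c m))\<^sup>2)"
  proof -
    have "(LINT x|lebesgue. G x * cnj (G x)) =
       (\<Sum>m\<in>M. \<Sum>m'\<in>M. LINT x|lebesgue. (c m * cnj (c m')) * (indicator I x *\<^sub>R (e m x * cnj (e m' x))))"
      unfolding GG_exp
      by (simp only: Bochner_Integration.integral_sum[OF ceI_sum] Bochner_Integration.integral_sum[OF ceI])
    also have "\<dots> = (\<Sum>m\<in>M. \<Sum>m'\<in>M. (c m * cnj (c m')) * (if m = m' then of_real T else 0))"
      by (simp only: integral_mult_right_zero ortho)
    also have "\<dots> = (\<Sum>m\<in>M. T * (c m * cnj (c m)))"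
      using M by (intro sum.cong refl) (simp add: if_distrib mult.commute cong: if_cong)
    finally show ?thesis by (simp add: complex_norm_square sum_distrib_left del: of_real_power)
  qed
  have Re_FG: "integrable lebesgue (\<lambda>x. 2 * Re (F x * cnj (G x)))"
    by (intro integrable_mult_right integrable_Re FG)
  have Re_GG: "integrable lebesgue (\<lambda>x. Re (G x * cnj (G x)))"
    by (intro integrable_Re GG)
  have sq: "(cmod (F x - G x))\<^sup>2 = (cmod (F x))\<^sup>2 - 2 * Re (F x * cnj (G x)) + Re (G x * cnj (G x))" for x
    unfolding cmod_power2 by (simp add: power2_eq_square algebra_simps)
  have "0 \<le> (LINT x|lebesgue. (cmod (F x - G x))\<^sup>2)" by simp
  also have "\<dots> = (LINT x|lebesgue. (cmod (F x))\<^sup>2) - 2 * Re (LINT x|lebesgue. F x * cnj (G x)) + Re (LINT x|lebesgue. G x * cnj (G x))"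
    unfolding sq
    by (simp only: Bochner_Integration.integral_add[OF Bochner_Integration.integrable_diff[OF F(2) Re_FG] Re_GG]
          Bochner_Integration.integral_diff[OF F(2) Re_FG] integral_mult_right_zero integral_Re[OF FG] integral_Re[OF GG])
  also have "\<dots> = (LINT x|lebesgue. (cmod (F x))\<^sup>2) - T * (\<Sum>m\<in>M. (cmod (c m))\<^sup>2)"
    unfolding FG_val GG_val by simp
  finally have "T * (\<Sum>m\<in>M. (cmod (c m))\<^sup>2) \<le> (LINT x|lebesgue. (cmod (F x))\<^sup>2)" by simp
  then have "T * (T * (\<Sum>m\<in>M. (cmod (c m))\<^sup>2)) \<le> T * (LINT x|lebesgue. (cmod (F x))\<^sup>2)"
    using T by simp
  moreover have "T * (T * (\<Sum>m\<in>M. (cmod (c m))\<^sup>2)) = (\<Sum>m\<in>M. (cmod (LINT x|lebesgue. F x * cnj (e m x)))\<^sup>2)"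
    using T by (simp add: c_def norm_divide power_divide sum_distrib_left power2_eq_square)
  ultimately show ?thesis by (simp add: e_def)
qed

section \<open>Square integrable functions and Gabor atoms\<close>

lemma L2_measurable: "f \<in> L2 \<Longrightarrow> f \<in> borel_measurable lebesgue"
  and L2_integrable: "f \<in> L2 \<Longrightarrow> integrable lebesgue (\<lambda>x. (cmod (f x))\<^sup>2)"
  by (auto simp: L2_def)

lemma L2_norm_square: "(L2_norm f)\<^sup>2 = (LINT x|lebesgue. (cmod (f x))\<^sup>2)"
  by (simp add: L2_norm_def)

lemma L2_bounded_by:
  assumes "f \<in> L2" "g \<in> borel_measurable lebesgue" "\<And>x. cmod (g x) \<le> C * cmod (f x)"
  shows "g \<in> L2"
proof -
  have "integrable lebesgue (\<lambda>x. (cmod (g x))\<^sup>2)"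
  proof (rule Bochner_Integration.integrable_bound)
    show "integrable lebesgue (\<lambda>x. C\<^sup>2 * (cmod (f x))\<^sup>2)"
      using L2_integrable[OF assms(1)] by simp
    show "AE x in lebesgue. norm ((cmod (g x))\<^sup>2) \<le> norm (C\<^sup>2 * (cmod (f x))\<^sup>2)"
      using assms(3) by (auto intro!: AE_I2 simp: power_mult_distrib[symmetric] power_mono)
  qed (use assms(2) in measurable)
  then show ?thesis using assms(2) by (simp add: L2_def)
qed

lemma indicator_in_L2: "(\<lambda>x. indicator {a..<b::real} x) \<in> L2"
proof -
  have "integrable lebesgue (\<lambda>x. indicat_real {a..<b} x)"
    by (cases "a \<le> b") (auto intro!: integrable_real_indicator)
  moreover have "(cmod (indicator {a..<b} x))\<^sup>2 = indicat_real {a..<b} x" for x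
    by (simp add: indicator_def)
  ultimately show ?thesis by (auto simp: L2_def intro!: borel_measurable_indicator)
qed

lemma norm_add_square_le: "(norm (a + b))\<^sup>2 \<le> 2 * (norm a)\<^sup>2 + 2 * (norm b)\<^sup>2"
  for a b :: "'a :: real_normed_vector"
proof -
  have "(norm (a + b))\<^sup>2 \<le> (norm a + norm b)\<^sup>2"
    by (intro power_mono norm_triangle_ineq) auto
  also have "\<dots> \<le> 2 * (norm a)\<^sup>2 + 2 * (norm b)\<^sup>2"
    using sum_squares_bound[of "norm a" "norm b"] by (simp add: power2_sum)
  finally show ?thesis .
qed

lemma L2_add:
  assumes "f \<in> L2" "g \<in> L2"
  shows "(\<lambda>x. f x + g x) \<in> L2"
proof -
  have "integrable lebesgue (\<lambda>x. (cmod (f x + g x))\<^sup>2)"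
  proof (rule Bochner_Integration.integrable_bound)
    show "integrable lebesgue (\<lambda>x. 2 * (cmod (f x))\<^sup>2 + 2 * (cmod (g x))\<^sup>2)"
      using assms L2_integrable by auto
    show "AE x in lebesgue. norm ((cmod (f x + g x))\<^sup>2) \<le> norm (2 * (cmod (f x))\<^sup>2 + 2 * (cmod (g x))\<^sup>2)"
      using norm_add_square_le by (auto intro!: AE_I2)
  qed (use assms L2_measurable in measurable)
  then show ?thesis using assms by (auto simp: L2_def)
qed

lemma L2_mult_integrable:
  assumes "f \<in> L2" "g \<in> L2"
  shows "integrable lebesgue (\<lambda>x. f x * cnj (g x))"
proof (rule Bochner_Integration.integrable_bound)
  show "integrable lebesgue (\<lambda>x. (cmod (f x))\<^sup>2 + (cmod (g x))\<^sup>2)"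
    using assms L2_integrable by auto
  have "cmod (f x) * cmod (g x) \<le> (cmod (f x))\<^sup>2 + (cmod (g x))\<^sup>2" for x
  proof -
    have "0 \<le> cmod (f x) * cmod (g x)" by simp
    then show ?thesis using sum_squares_bound[of "cmod (f x)" "cmod (g x)"]
      unfolding mult.assoc by linarith
  qed
  then show "AE x in lebesgue. norm (f x * cnj (g x)) \<le> norm ((cmod (f x))\<^sup>2 + (cmod (g x))\<^sup>2)"
    by (auto intro!: AE_I2 simp: norm_mult)
qed (use assms L2_measurable in \<open>auto intro!: borel_measurable_times borel_measurable_cnj\<close>)

lemma measurable_affine_lebesgue:
  fixes f :: "real \<Rightarrow> complex"
  assumes "c \<noteq> 0" "f \<in> borel_measurable lebesgue"
  shows "(\<lambda>x. f (t + c * x)) \<in> borel_measurable lebesgue"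
proof -
  have "(\<lambda>x. t + c * x) \<in> lebesgue \<rightarrow>\<^sub>M lebesgue"
    using lebesgue_affine_measurable[where c = "\<lambda>x::real. c"] assms(1) by simp
  from measurable_compose[OF this assms(2)] show ?thesis .
qed

lemma L2_affine:
  assumes "c \<noteq> 0" "f \<in> L2"
  shows "(\<lambda>x. f (t + c * x)) \<in> L2"
  using measurable_affine_lebesgue[of c f t] assms
    lebesgue_integrable_real_affine_iff[of c "\<lambda>x. (cmod (f x))\<^sup>2" t]
  by (simp add: L2_def)

lemma gabor_atom_measurable:
  assumes "g \<in> borel_measurable lebesgue"
  shows "gabor_atom g \<alpha> \<beta> n m \<in> borel_measurable lebesgue"
proof -
  have "(\<lambda>x. g (x - of_int n * \<alpha>)) \<in> borel_measurable lebesgue"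
    using measurable_affine_lebesgue[OF _ assms, of 1 "- (of_int n * \<alpha>)"] by simp
  moreover have "(\<lambda>x. cis (2 * pi * of_int m * \<beta> * x)) \<in> borel_measurable lebesgue"
    by (auto intro!: measurable_completion borel_measurable_continuous_onI continuous_intros)
  ultimately show ?thesis unfolding gabor_atom_def[abs_def] by measurable
qed

lemma gabor_atom_in_L2:
  assumes "g \<in> L2"
  shows "gabor_atom g \<alpha> \<beta> n m \<in> L2"
proof (rule L2_bounded_by[where C = 1])
  show "(\<lambda>x. g (- (of_int n * \<alpha>) + 1 * x)) \<in> L2" by (rule L2_affine) (use assms in auto)
qed (auto simp: gabor_atom_def norm_mult intro: gabor_atom_measurable L2_measurable[OF assms])

section \<open>Bessel bounds for Gabor systems\<close>

lemma card_ints_in_interval: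
  fixes u v :: real and N :: "int set"
  assumes "finite N" "u \<le> v" "\<And>n. n \<in> N \<Longrightarrow> u < of_int n \<and> of_int n \<le> v"
  shows "real (card N) \<le> v - u + 1"
proof -
  have "N \<subseteq> {\<lfloor>u\<rfloor> + 1..\<lfloor>v\<rfloor>}"
    using assms(3) by (auto simp: le_floor_iff) (smt (verit) floor_less_iff)
  then have "card N \<le> card {\<lfloor>u\<rfloor> + 1..\<lfloor>v\<rfloor>}" by (intro card_mono) auto
  also have "\<dots> = nat (\<lfloor>v\<rfloor> - \<lfloor>u\<rfloor>)" by simp
  finally have "real (card N) \<le> of_int (\<lfloor>v\<rfloor> - \<lfloor>u\<rfloor>)"
    using assms(2) floor_mono[OF assms(2)] by linarith
  then show ?thesis by linarith
qed

text \<open>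
  A point lies in at most \<open>l / \<alpha> + 1\<close> of the translates by multiples of \<open>\<alpha>\<close> of an interval of
  length \<open>l\<close>.
\<close>

lemma sum_integrals_over_translates:
  fixes F :: "real \<Rightarrow> real" and \<alpha> l a :: real and N :: "int set"
  assumes N: "finite N" and \<alpha>: "\<alpha> > 0" and l: "l > 0"
    and F: "integrable lebesgue F" "\<And>x. F x \<ge> 0"
  shows "(\<Sum>n\<in>N. LINT x|lebesgue. indicator {a + of_int n * \<alpha>..<a + of_int n * \<alpha> + l} x * F x)
           \<le> (l / \<alpha> + 1) * (LINT x|lebesgue. F x)"
proof -
  let ?I = "\<lambda>n::int. {a + of_int n * \<alpha>..<a + of_int n * \<alpha> + l}"
  have int: "integrable lebesgue (\<lambda>x. indicator (?I n) x * F x)" for n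
    using integrable_mult_indicator[of "?I n" lebesgue F] F(1) by simp
  have "(\<Sum>n\<in>N. LINT x|lebesgue. indicator (?I n) x * F x)
      = (LINT x|lebesgue. (\<Sum>n\<in>N. indicator (?I n) x * F x))"
    using int by (subst Bochner_Integration.integral_sum) auto
  also have "\<dots> \<le> (LINT x|lebesgue. (l / \<alpha> + 1) * F x)"
  proof (rule integral_mono)
    fix x
    have "(\<Sum>n\<in>N. indicator (?I n) x) = real (card {n\<in>N. x \<in> ?I n})"
      using N by (simp add: indicator_def sum.If_cases Int_def)
    also have "\<dots> \<le> (x - a) / \<alpha> - (x - a - l) / \<alpha> + 1"
      by (rule card_ints_in_interval) (use N \<alpha> l in \<open>auto simp: field_simps\<close>)
    also have "\<dots> = l / \<alpha> + 1" by (simp add: diff_divide_distrib)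
    finally show "(\<Sum>n\<in>N. indicator (?I n) x * F x) \<le> (l / \<alpha> + 1) * F x"
      unfolding sum_distrib_right[symmetric] by (intro mult_right_mono F(2)) auto
  qed (use int F(1) in auto)
  finally show ?thesis by simp
qed

text \<open>
  For fixed \<open>n\<close> the sum over \<open>m\<close> is controlled by Bessel's inequality for exponentials. The interval
  carrying the window may be longer than the period \<open>1 / \<beta>\<close>; but the frequencies \<open>m \<beta>\<close> are
  among the frequencies \<open>m' \<beta> / P\<close>, so the inequality for the longer period \<open>P / \<beta>\<close> applies. The
  finite overlap of the translated intervals then gives the sum over \<open>n\<close>.
\<close>

lemma gabor_bessel_bound_short_window:
  fixes f \<psi> :: "real \<Rightarrow> complex" and P :: nat
  assumes f: "f \<in> L2" and \<psi>: "\<psi> \<in> borel_measurable lebesgue"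
    and \<psi>_le: "\<And>x. cmod (\<psi> x) \<le> indicator {a..<a + l} x"
    and pos: "\<alpha> > 0" "\<beta> > 0" "l > 0" "P > 0" and P: "l * \<beta> \<le> real P"
    and fin: "finite N" "finite M"
  shows "(\<Sum>n\<in>N. \<Sum>m\<in>M. (cmod (L2_inner f (gabor_atom \<psi> \<alpha> \<beta> n m)))\<^sup>2)
           \<le> real P / \<beta> * (l / \<alpha> + 1) * (L2_norm f)\<^sup>2"
proof -
  define T where "T = real P / \<beta>"
  have T: "T > 0" "l \<le> T" using pos P by (auto simp: T_def field_simps)
  let ?I = "\<lambda>n::int. {a + of_int n * \<alpha>..<a + of_int n * \<alpha> + l}"
  have one: "(\<Sum>m\<in>M. (cmod (L2_inner f (gabor_atom \<psi> \<alpha> \<beta> n m)))\<^sup>2)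
      \<le> T * (LINT x|lebesgue. indicator (?I n) x * (cmod (f x))\<^sup>2)" for n :: int
  proof -
    define F where "F x = f x * cnj (\<psi> (x - of_int n * \<alpha>))" for x
    have F_le: "cmod (F x) \<le> indicator (?I n) x * cmod (f x)" for x
      using mult_left_mono[OF \<psi>_le[of "x - of_int n * \<alpha>"], of "cmod (f x)"]
      by (auto simp: F_def norm_mult indicator_def algebra_simps)
    have \<psi>n: "(\<lambda>x. \<psi> (x - of_int n * \<alpha>)) \<in> borel_measurable lebesgue"
      using measurable_affine_lebesgue[OF _ \<psi>, of 1 "- (of_int n * \<alpha>)"] by simp
    have Fm: "F \<in> borel_measurable lebesgue"
      unfolding F_def[abs_def]
      by (intro borel_measurable_times borel_measurable_cnj \<psi>n L2_measurable f)
    have F_L2: "F \<in> L2"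
      using f Fm by (rule L2_bounded_by[where C = 1]) 
         (use F_le in \<open>fastforce simp: indicator_def intro: order_trans split: if_splits\<close>)
    have ind_L2: "(\<lambda>x. indicator (?I n) x) \<in> L2" by (rule indicator_in_L2)
    have F_eq: "F x = F x * cnj (indicator (?I n) x)" for x
      using F_le[of x] by (cases "x \<in> ?I n") simp_all
    have F_int: "integrable lebesgue F"
      using L2_mult_integrable[OF F_L2 ind_L2] by (simp only: F_eq[symmetric])
    have supp: "F x = 0" if "x \<notin> {a + of_int n * \<alpha>..<a + of_int n * \<alpha> + T}" for x
      using F_le[of x] that T by (auto simp: indicator_def split: if_splits)
    \<comment> \<open>The frequency \<open>m\<close> of period \<open>1 / \<beta>\<close> is the frequency \<open>m P\<close> of period \<open>T\<close>.\<close>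
    have inner: "L2_inner f (gabor_atom \<psi> \<alpha> \<beta> n m)
         = (LINT x|lebesgue. F x * cnj (cis (2 * pi * of_int (m * int P) * x / T)))" for m
      using pos by (simp add: L2_inner_def gabor_atom_def F_def T_def mult_ac)
    have inj: "inj_on (\<lambda>m. m * int P) M" using pos by (auto intro!: inj_onI)
    have "(\<Sum>m\<in>M. (cmod (L2_inner f (gabor_atom \<psi> \<alpha> \<beta> n m)))\<^sup>2)
      = (\<Sum>m\<in>(\<lambda>m. m * int P) ` M. (cmod (LINT x|lebesgue. F x * cnj (cis (2 * pi * of_int m * x / T))))\<^sup>2)"
      unfolding inner by (subst sum.reindex[OF inj]) simp
    also have "\<dots> \<le> T * (LINT x|lebesgue. (cmod (F x))\<^sup>2)"
      using T(1) _ F_int L2_integrable[OF F_L2] supp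
      by (rule bessel_inequality_exponentials) (use fin in auto)
    also have "\<dots> \<le> T * (LINT x|lebesgue. indicator (?I n) x * (cmod (f x))\<^sup>2)"
    proof (intro mult_left_mono integral_mono)
      show "integrable lebesgue (\<lambda>x. indicator (?I n) x * (cmod (f x))\<^sup>2)"
        using integrable_mult_indicator[OF _ L2_integrable[OF f], of "?I n"] by simp
      fix x show "(cmod (F x))\<^sup>2 \<le> indicator (?I n) x * (cmod (f x))\<^sup>2"
        using power_mono[OF F_le, of x 2] by (auto simp: indicator_def)
    qed (use T L2_integrable[OF F_L2] in auto)
    finally show ?thesis .
  qed
  have "(\<Sum>n\<in>N. \<Sum>m\<in>M. (cmod (L2_inner f (gabor_atom \<psi> \<alpha> \<beta> n m)))\<^sup>2)
     \<le> T * (\<Sum>n\<in>N. LINT x|lebesgue. indicator (?I n) x * (cmod (f x))\<^sup>2)"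
    unfolding sum_distrib_left by (intro sum_mono one)
  also have "\<dots> \<le> T * ((l / \<alpha> + 1) * (L2_norm f)\<^sup>2)"
    unfolding L2_norm_square
    by (intro mult_left_mono sum_integrals_over_translates) (use fin pos T L2_integrable[OF f] in auto)
  finally show ?thesis by (simp add: T_def mult.assoc)
qed

text \<open>
  The bound is required for finite partial sums, so that it is a statement about real numbers and
  no convergence has to be discussed. Membership in \<open>L2\<close> makes all inner products with
  elements of \<open>L2\<close> absolutely convergent, hence additive in the window.
\<close>

definition gabor_bessel :: "(real \<Rightarrow> complex) \<Rightarrow> real \<Rightarrow> real \<Rightarrow> real \<Rightarrow> bool" where
  "gabor_bessel \<phi> \<alpha> \<beta> B \<longleftrightarrow> \<phi> \<in> L2 \<and> (\<forall>f\<in>L2. \<forall>X. finite X \<longrightarrow>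
     (\<Sum>(n, m)\<in>X. (cmod (L2_inner f (gabor_atom \<phi> \<alpha> \<beta> n m)))\<^sup>2) \<le> B * (L2_norm f)\<^sup>2)"

lemma gabor_bessel_mono: "gabor_bessel \<phi> \<alpha> \<beta> B \<Longrightarrow> B \<le> B' \<Longrightarrow> gabor_bessel \<phi> \<alpha> \<beta> B'"
  unfolding gabor_bessel_def by (meson mult_right_mono order_trans zero_le_power2)

lemma gabor_bessel_add:
  assumes "gabor_bessel \<phi> \<alpha> \<beta> B" "gabor_bessel \<psi> \<alpha> \<beta> C"
  shows "gabor_bessel (\<lambda>x. \<phi> x + \<psi> x) \<alpha> \<beta> (2 * B + 2 * C)"
  unfolding gabor_bessel_def
proof (intro conjI ballI allI impI)
  have L2: "\<phi> \<in> L2" "\<psi> \<in> L2" using assms by (auto simp: gabor_bessel_def)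
  then show "(\<lambda>x. \<phi> x + \<psi> x) \<in> L2" by (rule L2_add)
  fix f :: "real \<Rightarrow> complex" and X :: "(int \<times> int) set" assume f: "f \<in> L2" and X: "finite X"
  let ?a = "\<lambda>n m. L2_inner f (gabor_atom \<phi> \<alpha> \<beta> n m)" and ?b = "\<lambda>n m. L2_inner f (gabor_atom \<psi> \<alpha> \<beta> n m)"
  have "L2_inner f (gabor_atom (\<lambda>x. \<phi> x + \<psi> x) \<alpha> \<beta> n m) = ?a n m + ?b n m" for n m
    using L2_mult_integrable[OF f gabor_atom_in_L2[OF L2(1)], of \<alpha> \<beta> n m]
      L2_mult_integrable[OF f gabor_atom_in_L2[OF L2(2)], of \<alpha> \<beta> n m]
    unfolding L2_inner_def
    by (subst Bochner_Integration.integral_add[symmetric]) (auto simp: gabor_atom_def algebra_simps)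
  then have "(\<Sum>(n, m)\<in>X. (cmod (L2_inner f (gabor_atom (\<lambda>x. \<phi> x + \<psi> x) \<alpha> \<beta> n m)))\<^sup>2)
     \<le> (\<Sum>(n, m)\<in>X. 2 * (cmod (?a n m))\<^sup>2 + 2 * (cmod (?b n m))\<^sup>2)"
    by (intro sum_mono) (auto intro: norm_add_square_le)
  also have "\<dots> = 2 * (\<Sum>(n, m)\<in>X. (cmod (?a n m))\<^sup>2) + 2 * (\<Sum>(n, m)\<in>X. (cmod (?b n m))\<^sup>2)"
    by (simp add: case_prod_unfold sum.distrib sum_distrib_left)
  also have "\<dots> \<le> 2 * (B * (L2_norm f)\<^sup>2) + 2 * (C * (L2_norm f)\<^sup>2)"
    using assms f X by (intro add_mono mult_left_mono) (auto simp: gabor_bessel_def)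
  finally show "(\<Sum>(n, m)\<in>X. (cmod (L2_inner f (gabor_atom (\<lambda>x. \<phi> x + \<psi> x) \<alpha> \<beta> n m)))\<^sup>2)
     \<le> (2 * B + 2 * C) * (L2_norm f)\<^sup>2" by (simp add: algebra_simps)
qed

lemma gabor_bessel_scale:
  assumes "gabor_bessel \<phi> \<alpha> \<beta> B"
  shows "gabor_bessel (\<lambda>x. c * \<phi> x) \<alpha> \<beta> ((cmod c)\<^sup>2 * B)"
  unfolding gabor_bessel_def
proof (intro conjI ballI allI impI)
  have L2: "\<phi> \<in> L2" using assms by (auto simp: gabor_bessel_def)
  then show "(\<lambda>x. c * \<phi> x) \<in> L2"
    by (rule L2_bounded_by[where C = "cmod c"]) (use L2_measurable[OF L2] in \<open>auto simp: norm_mult\<close>)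
  fix f :: "real \<Rightarrow> complex" and X :: "(int \<times> int) set" assume f: "f \<in> L2" and X: "finite X"
  have "L2_inner f (gabor_atom (\<lambda>x. c * \<phi> x) \<alpha> \<beta> n m) = cnj c * L2_inner f (gabor_atom \<phi> \<alpha> \<beta> n m)" for n m
    unfolding L2_inner_def integral_mult_right_zero[symmetric]
    by (simp add: gabor_atom_def mult_ac)
  then have "(\<Sum>(n, m)\<in>X. (cmod (L2_inner f (gabor_atom (\<lambda>x. c * \<phi> x) \<alpha> \<beta> n m)))\<^sup>2)
     = (cmod c)\<^sup>2 * (\<Sum>(n, m)\<in>X. (cmod (L2_inner f (gabor_atom \<phi> \<alpha> \<beta> n m)))\<^sup>2)"
    by (simp add: norm_mult power_mult_distrib case_prod_unfold sum_distrib_left)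
  also have "\<dots> \<le> (cmod c)\<^sup>2 * (B * (L2_norm f)\<^sup>2)"
    using assms f X by (intro mult_left_mono) (auto simp: gabor_bessel_def)
  finally show "(\<Sum>(n, m)\<in>X. (cmod (L2_inner f (gabor_atom (\<lambda>x. c * \<phi> x) \<alpha> \<beta> n m)))\<^sup>2)
     \<le> (cmod c)\<^sup>2 * B * (L2_norm f)\<^sup>2" by (simp add: mult.assoc)
qed

text \<open>
  The square of the window is dominated by \<open>S\<close> times the step function with values \<open>s k\<close>, whose
  integral is at most \<open>L * S\<close>.
\<close>

lemma amalgam_in_L2:
  fixes \<phi> :: "real \<Rightarrow> complex" and s :: "int \<Rightarrow> real"
  assumes meas: "\<phi> \<in> borel_measurable lebesgue" and L: "L > 0"
    and s0: "\<And>k. 0 \<le> s k" and S: "\<And>K. finite K \<Longrightarrow> sum s K \<le> S"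
    and dom: "\<And>x. cmod (\<phi> x) \<le> s \<lfloor>x / L\<rfloor>"
  shows "\<phi> \<in> L2"
proof -
  define u where "u x = s \<lfloor>x / L\<rfloor>" for x :: real
  define K where "K i = {- int i..<int i}" for i :: nat
  define J where "J k = {of_int k * L..<(of_int k + 1) * L}" for k :: int
  have J_iff: "x \<in> J k \<longleftrightarrow> \<lfloor>x / L\<rfloor> = k" for x k
    using L by (auto simp: J_def floor_eq_iff field_simps)
  define v where "v i x = (\<Sum>k\<in>K i. s k * indicator (J k) x)" for i x
  have v_eq: "v i x = (if \<lfloor>x / L\<rfloor> \<in> K i then u x else 0)" for i x
    by (auto simp: v_def u_def indicator_def J_iff K_def if_distrib cong: if_cong)
  have J_int: "integrable lebesgue (\<lambda>x. s k * indicator (J k) x)" for k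
    using L unfolding J_def by (intro integrable_mult_right integrable_real_indicator) (auto simp: distrib_right)
  have v_int: "integrable lebesgue (v i)" for i
    unfolding v_def[abs_def] by (intro Bochner_Integration.integrable_sum J_int)
  have v_val: "integral\<^sup>L lebesgue (v i) = L * (\<Sum>k\<in>K i. s k)" for i
  proof -
    have "integral\<^sup>L lebesgue (v i) = (\<Sum>k\<in>K i. s k * L)"
      unfolding v_def[abs_def] using L
      by (subst Bochner_Integration.integral_sum[OF J_int]) (auto simp: J_def algebra_simps)
    then show ?thesis by (simp add: sum_distrib_left mult.commute)
  qed
  have inc: "incseq (\<lambda>i. integral\<^sup>L lebesgue (v i))"
    unfolding v_val using L s0 by (auto intro!: incseq_SucI mult_left_mono sum_mono2 simp: K_def)
  have "\<exists>l. (\<lambda>i. integral\<^sup>L lebesgue (v i)) \<longlonglongrightarrow> l"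
    by (rule incseq_convergent[OF inc, of "L * S"])
       (use L S in \<open>auto simp: v_val K_def intro!: mult_left_mono\<close>)
  then obtain l where l: "(\<lambda>i. integral\<^sup>L lebesgue (v i)) \<longlonglongrightarrow> l" by blast
  have lim: "(\<lambda>i. v i x) \<longlonglongrightarrow> u x" for x
  proof (rule tendsto_eventually)
    show "eventually (\<lambda>i. v i x = u x) sequentially"
      using eventually_ge_at_top[of "nat (\<bar>\<lfloor>x / L\<rfloor>\<bar> + 1)"]
      by eventually_elim (auto simp: v_eq K_def)
  qed
  have u_int: "integrable lebesgue u"
  proof (rule integrable_monotone_convergence[OF v_int _ _ l])
    show "AE x in lebesgue. mono (\<lambda>i. v i x)"
      using s0 by (auto intro!: AE_I2 incseq_SucI simp: v_eq K_def u_def)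
    show "AE x in lebesgue. (\<lambda>i. v i x) \<longlonglongrightarrow> u x" using lim by auto
    show "u \<in> borel_measurable lebesgue"
      by (rule borel_measurable_LIMSEQ_real[OF lim]) (use v_int in auto)
  qed
  have "integrable lebesgue (\<lambda>x. (cmod (\<phi> x))\<^sup>2)"
  proof (rule Bochner_Integration.integrable_bound)
    show "integrable lebesgue (\<lambda>x. S * u x)" using u_int by simp
    have "(cmod (\<phi> x))\<^sup>2 \<le> S * u x" for x
    proof -
      have "u x \<le> S" using S[of "{\<lfloor>x / L\<rfloor>}"] by (simp add: u_def)
      then show ?thesis
        unfolding power2_eq_square using dom[of x] s0[of "\<lfloor>x / L\<rfloor>"] by (intro mult_mono) (auto simp: u_def)
    qed
    then show "AE x in lebesgue. norm ((cmod (\<phi> x))\<^sup>2) \<le> norm (S * u x)"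
      by (auto intro!: AE_I2 intro: order_trans[OF _ abs_ge_self])
  qed (use meas in measurable)
  then show ?thesis using meas by (simp add: L2_def)
qed

text \<open>
  This is the Bessel bound for windows in the Wiener algebra. Cut the window into the pieces living
  on the cells of a grid of step \<open>L\<close>; after division by \<open>s k\<close> each piece is a bounded window on a
  short interval and has a Bessel bound \<open>C\<close> that is the same for all cells. The Cauchy-Schwarz inequality with
  weights \<open>s k\<close>, whose total is at most \<open>S\<close>, recombines the pieces with the bound \<open>C * S\<^sup>2\<close>. It
  is applied to finitely many cells first, and dominated convergence removes the truncation. The step
  is a parameter because a dilated window is naturally dominated on a dilated grid.
\<close>

lemma gabor_bessel_amalgam:
  fixes \<phi> :: "real \<Rightarrow> complex" and s :: "int \<Rightarrow> real" and P :: nat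
  assumes meas: "\<phi> \<in> borel_measurable lebesgue"
    and pos: "\<alpha> > 0" "\<beta> > 0" "L > 0" "P > 0" and P: "L * \<beta> \<le> real P"
    and s0: "\<And>k. 0 \<le> s k" and S: "\<And>K. finite K \<Longrightarrow> sum s K \<le> S"
    and dom: "\<And>x. cmod (\<phi> x) \<le> s \<lfloor>x / L\<rfloor>"
  shows "gabor_bessel \<phi> \<alpha> \<beta> (real P / \<beta> * (L / \<alpha> + 1) * S\<^sup>2)"
  unfolding gabor_bessel_def
proof (intro conjI ballI allI impI)
  show \<phi>_L2: "\<phi> \<in> L2" by (rule amalgam_in_L2) fact+
  fix f :: "real \<Rightarrow> complex" and X :: "(int \<times> int) set" assume f: "f \<in> L2" and X: "finite X"
  define C where "C = real P / \<beta> * (L / \<alpha> + 1)"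
  have "C \<ge> 0" using pos by (simp add: C_def)
  have "S \<ge> 0" using S[of "{}"] by simp
  define J where "J k = {of_int k * L..<of_int k * L + L}" for k :: int
  have J_iff: "x \<in> J k \<longleftrightarrow> \<lfloor>x / L\<rfloor> = k" for x k
    using pos by (auto simp: J_def floor_eq_iff field_simps)
  define K where "K i = {- int i..<int i}" for i :: nat
  have K_fin: "finite (K i)" for i by (simp add: K_def)
  \<comment> \<open>Where \<open>s k = 0\<close>, domination forces the window to vanish on the cell, in accordance with
    \<open>\<phi> x / 0 = 0\<close>.\<close>
  define \<psi> where "\<psi> k x = indicator (J k) x *\<^sub>R (\<phi> x / of_real (s k))" for k x
  have \<psi>_meas: "\<psi> k \<in> borel_measurable lebesgue" for k
    unfolding \<psi>_def[abs_def] J_def using meas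
    by (intro borel_measurable_scaleR borel_measurable_indicator borel_measurable_divide) auto
  have \<psi>_le: "cmod (\<psi> k x) \<le> indicator (J k) x" for k x
    using dom[of x] s0[of k] by (auto simp: \<psi>_def indicator_def J_iff norm_divide divide_le_eq_1)
  have \<psi>_L2: "\<psi> k \<in> L2" for k
    using indicator_in_L2[of "of_int k * L" "of_int k * L + L"] \<psi>_meas
  proof (rule L2_bounded_by[where C = 1])
    show "cmod (\<psi> k x) \<le> 1 * cmod (indicator {of_int k * L..<of_int k * L + L} x)" for x
      using \<psi>_le[of k x] by (cases "x \<in> J k") (simp_all add: J_def)
  qed
  define \<phi>' where "\<phi>' i x = (\<Sum>k\<in>K i. s k * \<psi> k x)" for i x
  have \<phi>'_eq: "\<phi>' i x = (if \<lfloor>x / L\<rfloor> \<in> K i then \<phi> x else 0)" for i x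
  proof -
    have "s k * \<psi> k x = (if k = \<lfloor>x / L\<rfloor> then \<phi> x else 0)" for k
      using dom[of x] by (auto simp: \<psi>_def indicator_def J_iff)
    then show ?thesis using K_fin by (simp add: \<phi>'_def)
  qed
  define z where "z k n m = L2_inner f (gabor_atom (\<psi> k) \<alpha> \<beta> n m)" for k n m
  have z_int: "integrable lebesgue (\<lambda>x. f x * cnj (gabor_atom (\<psi> k) \<alpha> \<beta> n m x))" for k n m
    by (intro L2_mult_integrable f gabor_atom_in_L2 \<psi>_L2)
  have inner_\<phi>': "L2_inner f (gabor_atom (\<phi>' i) \<alpha> \<beta> n m) = (\<Sum>k\<in>K i. s k * z k n m)" for i n m
  proof -
    have "f x * cnj (gabor_atom (\<phi>' i) \<alpha> \<beta> n m x)
        = (\<Sum>k\<in>K i. s k * (f x * cnj (gabor_atom (\<psi> k) \<alpha> \<beta> n m x)))" for x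
      by (simp add: gabor_atom_def \<phi>'_def sum_distrib_left sum_distrib_right mult_ac)
    then show ?thesis
      unfolding L2_inner_def z_def using z_int
      by (simp add: Bochner_Integration.integral_sum)
  qed
  have partial: "(\<Sum>(n, m)\<in>X. (cmod (L2_inner f (gabor_atom (\<phi>' i) \<alpha> \<beta> n m)))\<^sup>2)
      \<le> C * S\<^sup>2 * (L2_norm f)\<^sup>2" for i
  proof -
    have cs: "(cmod (L2_inner f (gabor_atom (\<phi>' i) \<alpha> \<beta> n m)))\<^sup>2 \<le> S * (\<Sum>k\<in>K i. s k * (cmod (z k n m))\<^sup>2)" for n m
    proof -
      have "cmod (\<Sum>k\<in>K i. s k * z k n m) \<le> (\<Sum>k\<in>K i. sqrt (s k) * (sqrt (s k) * cmod (z k n m)))"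
        using s0 by (intro order_trans[OF norm_sum] sum_mono) (auto simp: norm_mult mult.assoc[symmetric])
      then have "(cmod (\<Sum>k\<in>K i. s k * z k n m))\<^sup>2 \<le> (\<Sum>k\<in>K i. sqrt (s k) * (sqrt (s k) * cmod (z k n m)))\<^sup>2"
        by (intro power_mono) auto
      also have "\<dots> \<le> (\<Sum>k\<in>K i. (sqrt (s k))\<^sup>2) * (\<Sum>k\<in>K i. (sqrt (s k) * cmod (z k n m))\<^sup>2)"
        by (rule Cauchy_Schwarz_ineq_sum)
      also have "\<dots> = (\<Sum>k\<in>K i. s k) * (\<Sum>k\<in>K i. s k * (cmod (z k n m))\<^sup>2)"
        using s0 by (simp add: power_mult_distrib)
      also have "\<dots> \<le> S * (\<Sum>k\<in>K i. s k * (cmod (z k n m))\<^sup>2)"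
        using s0 by (intro mult_right_mono S K_fin sum_nonneg) auto
      finally show ?thesis by (simp add: inner_\<phi>')
    qed
    have piece: "(\<Sum>(n, m)\<in>X. (cmod (z k n m))\<^sup>2) \<le> C * (L2_norm f)\<^sup>2" for k
    proof -
      have "(\<Sum>(n, m)\<in>X. (cmod (z k n m))\<^sup>2) \<le> (\<Sum>(n, m)\<in>fst ` X \<times> snd ` X. (cmod (z k n m))\<^sup>2)"
        using X by (intro sum_mono2) (auto intro: rev_image_eqI)
      also have "\<dots> = (\<Sum>n\<in>fst ` X. \<Sum>m\<in>snd ` X. (cmod (z k n m))\<^sup>2)"
        by (simp add: sum.cartesian_product)
      also have "\<dots> \<le> C * (L2_norm f)\<^sup>2"
        unfolding C_def z_def using f \<psi>_meas \<psi>_le[unfolded J_def] pos P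
        by (rule gabor_bessel_bound_short_window) (use X in auto)
      finally show ?thesis .
    qed
    have "(\<Sum>(n, m)\<in>X. (cmod (L2_inner f (gabor_atom (\<phi>' i) \<alpha> \<beta> n m)))\<^sup>2)
        \<le> (\<Sum>(n, m)\<in>X. S * (\<Sum>k\<in>K i. s k * (cmod (z k n m))\<^sup>2))"
      by (intro sum_mono) (auto intro: cs)
    also have "\<dots> = S * (\<Sum>k\<in>K i. s k * (\<Sum>(n, m)\<in>X. (cmod (z k n m))\<^sup>2))"
      by (simp add: case_prod_unfold sum_distrib_left, subst sum.swap, simp)
    also have "\<dots> \<le> S * (\<Sum>k\<in>K i. s k * (C * (L2_norm f)\<^sup>2))"
      using \<open>S \<ge> 0\<close> s0 piece by (intro mult_left_mono sum_mono) auto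
    also have "\<dots> = S * (\<Sum>k\<in>K i. s k) * (C * (L2_norm f)\<^sup>2)"
      by (simp add: sum_distrib_right mult.assoc)
    also have "\<dots> \<le> S * S * (C * (L2_norm f)\<^sup>2)"
      using \<open>S \<ge> 0\<close> \<open>C \<ge> 0\<close> S[OF K_fin] by (intro mult_right_mono mult_left_mono) auto
    finally show ?thesis by (simp add: power2_eq_square mult_ac)
  qed
  have lim: "(\<lambda>i. L2_inner f (gabor_atom (\<phi>' i) \<alpha> \<beta> n m)) \<longlonglongrightarrow> L2_inner f (gabor_atom \<phi> \<alpha> \<beta> n m)" for n m
    unfolding L2_inner_def
  proof (rule integral_dominated_convergence[where w = "\<lambda>x. cmod (f x * cnj (gabor_atom \<phi> \<alpha> \<beta> n m x))"])
    have int: "integrable lebesgue (\<lambda>x. f x * cnj (gabor_atom \<phi> \<alpha> \<beta> n m x))"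
      by (intro L2_mult_integrable f gabor_atom_in_L2 \<phi>_L2)
    then show "(\<lambda>x. f x * cnj (gabor_atom \<phi> \<alpha> \<beta> n m x)) \<in> borel_measurable lebesgue"
      "integrable lebesgue (\<lambda>x. cmod (f x * cnj (gabor_atom \<phi> \<alpha> \<beta> n m x)))" by auto
    show "(\<lambda>x. f x * cnj (gabor_atom (\<phi>' i) \<alpha> \<beta> n m x)) \<in> borel_measurable lebesgue" for i
      unfolding \<phi>'_def[abs_def] using \<psi>_meas
      by (intro borel_measurable_times borel_measurable_cnj gabor_atom_measurable L2_measurable[OF f] borel_measurable_sum) auto
    show "AE x in lebesgue. (\<lambda>i. f x * cnj (gabor_atom (\<phi>' i) \<alpha> \<beta> n m x)) \<longlonglongrightarrow> f x * cnj (gabor_atom \<phi> \<alpha> \<beta> n m x)"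
    proof (intro AE_I2 tendsto_eventually)
      fix x :: real
      let ?y = "x - of_int n * \<alpha>"
      show "\<forall>\<^sub>F i in sequentially. f x * cnj (gabor_atom (\<phi>' i) \<alpha> \<beta> n m x) = f x * cnj (gabor_atom \<phi> \<alpha> \<beta> n m x)"
        using eventually_ge_at_top[of "nat (\<bar>\<lfloor>?y / L\<rfloor>\<bar> + 1)"]
        by eventually_elim (auto simp: gabor_atom_def \<phi>'_eq K_def)
    qed
    show "AE x in lebesgue. norm (f x * cnj (gabor_atom (\<phi>' i) \<alpha> \<beta> n m x)) \<le> cmod (f x * cnj (gabor_atom \<phi> \<alpha> \<beta> n m x))" for i
      by (auto intro!: AE_I2 simp: gabor_atom_def \<phi>'_eq norm_mult)
  qed
  have "(\<lambda>i. \<Sum>(n, m)\<in>X. (cmod (L2_inner f (gabor_atom (\<phi>' i) \<alpha> \<beta> n m)))\<^sup>2)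
     \<longlonglongrightarrow> (\<Sum>(n, m)\<in>X. (cmod (L2_inner f (gabor_atom \<phi> \<alpha> \<beta> n m)))\<^sup>2)"
    unfolding case_prod_unfold by (intro tendsto_sum tendsto_power tendsto_norm lim)
  then show "(\<Sum>(n, m)\<in>X. (cmod (L2_inner f (gabor_atom \<phi> \<alpha> \<beta> n m)))\<^sup>2) \<le> real P / \<beta> * (L / \<alpha> + 1) * S\<^sup>2 * (L2_norm f)\<^sup>2"
    by (rule LIMSEQ_le_const2) (use partial in \<open>auto simp: C_def\<close>)
qed

section \<open>Schwartz functions\<close>

lemma has_vector_derivative_dilation:
  fixes f :: "real \<Rightarrow> complex"
  assumes "f differentiable at (r * x)"
  shows "((\<lambda>x. f (r * x)) has_vector_derivative of_real r * vector_derivative f (at (r * x))) (at x)"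
proof -
  have "(f has_vector_derivative vector_derivative f (at (r * x))) (at (r * x))"
    using assms vector_derivative_works by blast
  moreover have "((\<lambda>x. r * x) has_vector_derivative r) (at x)"
    by (auto intro!: derivative_eq_intros)
  ultimately show ?thesis
    using vector_diff_chain_at[of "\<lambda>x. r * x" r x f "vector_derivative f (at (r * x))"]
    by (simp add: o_def scaleR_conv_of_real)
qed

lemma higher_vderiv_Suc: "higher_vderiv (Suc k) f x = vector_derivative (higher_vderiv k f) (at x)"
  by (simp add: higher_vderiv_def)

lemma higher_vderiv_dilation:
  assumes "\<And>k x. higher_vderiv k f differentiable at x"
  shows "higher_vderiv k (\<lambda>x. f (r * x)) = (\<lambda>x. of_real (r ^ k) * higher_vderiv k f (r * x))"
proof (induction k)
  case 0
  show ?case by (simp add: higher_vderiv_def)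
next
  case (Suc k)
  show ?case
  proof
    fix x
    have "((\<lambda>x. of_real (r ^ k) * higher_vderiv k f (r * x)) has_vector_derivative
        of_real (r ^ k) * (of_real r * vector_derivative (higher_vderiv k f) (at (r * x)))) (at x)"
      by (intro has_vector_derivative_mult_right has_vector_derivative_dilation assms)
    then show "higher_vderiv (Suc k) (\<lambda>x. f (r * x)) x = of_real (r ^ Suc k) * higher_vderiv (Suc k) f (r * x)"
      unfolding higher_vderiv_Suc Suc.IH by (simp add: vector_derivative_at mult_ac)
  qed
qed

text \<open>
  Needed because the change of variables in the inner products dilates the test function as well.
\<close>

lemma schwartz_dilation:
  assumes f: "f \<in> schwartz" and r: "r > 0"
  shows "(\<lambda>x. f (r * x)) \<in> schwartz"
proof -
  have diff: "higher_vderiv k f differentiable at x" for k x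
    using f unfolding schwartz_def by blast
  have bdd: "bounded (range (\<lambda>x. of_real (x ^ j) * higher_vderiv k f x))" for j k
    using f unfolding schwartz_def by blast
  note eq = higher_vderiv_dilation[OF diff]
  show ?thesis unfolding schwartz_def
  proof (intro CollectI allI conjI)
    fix k x
    from has_vector_derivative_mult_right[OF has_vector_derivative_dilation[OF diff[of k "r * x"]], of "of_real (r ^ k)"]
    have "(\<lambda>x. of_real (r ^ k) * higher_vderiv k f (r * x)) differentiable at x"
      by (rule differentiableI_vector)
    then show "higher_vderiv k (\<lambda>x. f (r * x)) differentiable at x" unfolding eq .
  next
    fix k j :: nat
    obtain D where D: "\<And>x. cmod (of_real (x ^ j) * higher_vderiv k f x) \<le> D"
      using bdd[of j k] by (auto simp: bounded_iff)
    have "cmod (of_real (x ^ j) * higher_vderiv k (\<lambda>x. f (r * x)) x) \<le> r ^ k / r ^ j * D" for x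
    proof -
      have "of_real (x ^ j) * higher_vderiv k (\<lambda>x. f (r * x)) x
          = of_real (r ^ k / r ^ j) * (of_real ((r * x) ^ j) * higher_vderiv k f (r * x))"
        unfolding eq using r by (simp add: power_mult_distrib field_simps)
      then show ?thesis
        using mult_left_mono[OF D[of "r * x"], of "r ^ k / r ^ j"] r
        by (simp add: norm_mult norm_divide norm_power)
    qed
    then show "bounded (range (\<lambda>x. of_real (x ^ j) * higher_vderiv k (\<lambda>x. f (r * x)) x))"
      by (auto simp: bounded_iff)
  qed
qed

lemma schwartz_continuous: "f \<in> schwartz \<Longrightarrow> continuous_on UNIV f"
proof -
  assume "f \<in> schwartz"
  then have "higher_vderiv 0 f differentiable at x" for x unfolding schwartz_def by blast
  then have "f differentiable at x" for x by (simp add: higher_vderiv_def)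
  then show "continuous_on UNIV f"
    by (intro continuous_at_imp_continuous_on ballI differentiable_imp_continuous_within)
qed

lemma schwartz_decay:
  assumes "f \<in> schwartz"
  shows "\<exists>D. \<forall>x. (1 + \<bar>x\<bar>) ^ j * cmod (f x) \<le> D"
proof -
  have "bounded (range (\<lambda>x. of_real (x ^ i) * f x))" for i
  proof -
    have "bounded (range (\<lambda>x. of_real (x ^ i) * higher_vderiv 0 f x))"
      using assms unfolding schwartz_def by blast
    then show ?thesis by (simp add: higher_vderiv_def)
  qed
  then obtain D where D: "\<And>i x. cmod (of_real (x ^ i) * f x) \<le> D i"
    unfolding bounded_iff by (metis rangeI)
  have "(1 + \<bar>x\<bar>) ^ j * cmod (f x) \<le> 2 ^ j * (D 0 + D j)" for x
  proof -
    have "(1 + \<bar>x\<bar>) ^ j \<le> 2 ^ j * (1 + \<bar>x\<bar> ^ j)"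
    proof (cases "\<bar>x\<bar> \<le> 1")
      case True
      then have "(1 + \<bar>x\<bar>) ^ j \<le> 2 ^ j" by (intro power_mono) auto
      then show ?thesis by (rule order_trans) simp
    next
      case False
      then have "(1 + \<bar>x\<bar>) ^ j \<le> (2 * \<bar>x\<bar>) ^ j" by (intro power_mono) auto
      then show ?thesis by (rule order_trans) (simp add: power_mult_distrib)
    qed
    then have "(1 + \<bar>x\<bar>) ^ j * cmod (f x) \<le> 2 ^ j * (1 + \<bar>x\<bar> ^ j) * cmod (f x)"
      by (intro mult_right_mono) auto
    also have "\<dots> = 2 ^ j * (cmod (f x) + \<bar>x\<bar> ^ j * cmod (f x))"
      by (simp add: algebra_simps)
    also have "\<dots> \<le> 2 ^ j * (D 0 + D j)"
      using D[of x 0] D[of x j] by (intro mult_left_mono add_mono) (simp_all add: norm_mult norm_power)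
    finally show ?thesis .
  qed
  then show ?thesis by blast
qed

lemma continuous_measurable_lebesgue:
  fixes f :: "real \<Rightarrow> complex"
  assumes "continuous_on UNIV f"
  shows "f \<in> borel_measurable lebesgue"
  using borel_measurable_continuous_onI[OF assms] by (intro measurable_completion) simp

lemma integrable_inverse_square: "integrable lebesgue (\<lambda>x::real. inverse (1 + x\<^sup>2))"
proof -
  have "integrable lborel (\<lambda>x::real. inverse (1 + x\<^sup>2))"
    using integrable_inverse_1_plus_square by (simp add: set_integrable_def)
  then show ?thesis by (subst integrable_completion) auto
qed

lemma integrable_schwartz_times_polynomial_growth:
  assumes f: "f \<in> schwartz" and w: "w \<in> borel_measurable lebesgue"
    and grow: "\<And>x. cmod (w x) \<le> D * (1 + \<bar>x\<bar>) ^ j"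
  shows "integrable lebesgue (\<lambda>x. f x * w x)"
proof -
  obtain E where E: "\<And>x. (1 + \<bar>x\<bar>) ^ (j + 2) * cmod (f x) \<le> E"
    using schwartz_decay[OF f, of "j + 2"] by blast
  show ?thesis
  proof (rule Bochner_Integration.integrable_bound)
    show "integrable lebesgue (\<lambda>x::real. (D * E) * inverse (1 + x\<^sup>2))"
      using integrable_inverse_square by simp
    have "f \<in> borel_measurable lebesgue"
      by (intro continuous_measurable_lebesgue schwartz_continuous f)
    then show "(\<lambda>x. f x * w x) \<in> borel_measurable lebesgue" using w by measurable
    have D: "D \<ge> 0" using order_trans[OF norm_ge_zero grow[of 0]] by simp
    have "cmod (f x * w x) \<le> (D * E) * inverse (1 + x\<^sup>2)" for x
    proof -
      have pos: "0 < 1 + x\<^sup>2" by (simp add: add_pos_nonneg)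
      have sq: "1 + x\<^sup>2 \<le> (1 + \<bar>x\<bar>)\<^sup>2" by (simp add: power2_sum)
      have "cmod (f x * w x) * (1 + x\<^sup>2) \<le> cmod (f x) * (D * (1 + \<bar>x\<bar>) ^ j) * (1 + \<bar>x\<bar>)\<^sup>2"
        unfolding norm_mult using D pos by (intro mult_mono sq mult_left_mono grow mult_nonneg_nonneg) auto
      also have "\<dots> = D * ((1 + \<bar>x\<bar>) ^ (j + 2) * cmod (f x))" by (simp add: power_add power2_eq_square mult_ac)
      also have "\<dots> \<le> D * E" using D E by (intro mult_left_mono) auto
      finally show ?thesis using pos by (simp add: divide_inverse[symmetric] pos_le_divide_eq)
    qed
    then show "AE x in lebesgue. norm (f x * w x) \<le> norm ((D * E) * inverse (1 + x\<^sup>2))"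
      by (intro AE_I2) (metis abs_ge_self order_trans real_norm_def)
  qed
qed

lemma schwartz_subset_L2: "schwartz \<subseteq> L2"
proof
  fix f assume f: "f \<in> schwartz"
  have meas: "f \<in> borel_measurable lebesgue"
    by (intro continuous_measurable_lebesgue schwartz_continuous f)
  obtain E where "\<And>x. (1 + \<bar>x\<bar>) ^ 0 * cmod (f x) \<le> E"
    using schwartz_decay[OF f, of 0] by blast
  then have E: "cmod (cnj (f x)) \<le> E * (1 + \<bar>x\<bar>) ^ 0" for x by simp
  have "integrable lebesgue (\<lambda>x. f x * cnj (f x))"
    by (rule integrable_schwartz_times_polynomial_growth[OF f _ E]) (rule borel_measurable_cnj[OF meas])
  from integrable_norm[OF this] show "f \<in> L2"
    using meas by (simp add: L2_def norm_mult power2_eq_square)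
qed

section \<open>Continuous functions in the Wiener algebra\<close>

text \<open>
  The set where the bound fails inside the interval is open and of measure zero, hence empty; by
  continuity the bound extends to the end points.
\<close>

lemma continuous_le_AE_bound:
  fixes h :: "real \<Rightarrow> complex" and a b c :: real
  assumes cont: "continuous_on UNIV h" and ab: "a < b"
    and ae: "AE x in restrict_space lebesgue {a<..<b}. cmod (h x) \<le> c"
    and x: "x \<in> {a..b}"
  shows "cmod (h x) \<le> c"
proof -
  define U where "U = {x. c < cmod (h x)} \<inter> {a<..<b}"
  have "open U" unfolding U_def
    by (intro open_Int open_Collect_less continuous_intros cont)
  have "AE x in lebesgue. x \<in> {a<..<b} \<longrightarrow> cmod (h x) \<le> c"
    using ae by (subst (asm) AE_restrict_space_iff) auto
  then have "AE x in lebesgue. x \<notin> U" by eventually_elim (auto simp: U_def)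
  then have "U \<in> null_sets lebesgue"
    using \<open>open U\<close> by (subst (asm) AE_iff_null_sets[symmetric]) auto
  then have "U = {}" using \<open>open U\<close> open_not_negligible negligible_iff_null_sets by blast
  then have "{a<..<b} \<subseteq> {x. cmod (h x) \<le> c}" by (auto simp: U_def disjoint_iff not_less)
  moreover have "closed {x. cmod (h x) \<le> c}"
    by (intro closed_Collect_le continuous_intros cont)
  ultimately have "closure {a<..<b} \<subseteq> {x. cmod (h x) \<le> c}" by (rule closure_minimal)
  then show ?thesis using ab x by auto
qed

text \<open>
  For a continuous function the essential suprema in the Wiener norm are true pointwise bounds. They
  are finite with a finite sum, so they can be handled as a summable family of real numbers.
\<close>

lemma wiener_W0_pointwise_bound:
  assumes "h \<in> wiener_W0"
  obtains s :: "int \<Rightarrow> real" where "\<And>k. 0 \<le> s k" "s summable_on UNIV" "\<And>x. cmod (h x) \<le> s \<lfloor>x\<rfloor>"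
proof -
  define e where "e n = esssup (restrict_space lebesgue {real_of_int n<..<real_of_int n + 1}) (\<lambda>x. ennreal (cmod (h x)))" for n
  have fin: "(\<Sum>\<^sub>\<infinity>n\<in>UNIV. e n) < \<infinity>" and cont: "continuous_on UNIV h"
    using assms by (auto simp: wiener_W0_def wiener_W_def wiener_norm_def e_def)
  have part: "sum e K \<le> (\<Sum>\<^sub>\<infinity>n\<in>UNIV. e n)" if "finite K" for K
    using that by (subst nonneg_infsum_complete) (auto intro: SUP_upper)
  have e_fin: "e n < \<infinity>" for n using part[of "{n}"] fin by (auto intro: le_less_trans)
  define s where "s n = enn2real (e n)" for n
  have s_nonneg: "0 \<le> s n" for n by (simp add: s_def)
  have s_e: "ennreal (s n) = e n" for n using e_fin[of n] by (simp add: s_def)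
  show thesis
  proof
    show "0 \<le> s k" for k by (simp add: s_def)
    show "s summable_on UNIV"
    proof (rule nonneg_bdd_above_summable_on)
      show "bdd_above (sum s ` {F. F \<subseteq> UNIV \<and> finite F})"
      proof (rule bdd_aboveI2)
        fix F assume "F \<in> {F::int set. F \<subseteq> UNIV \<and> finite F}"
        then have "ennreal (sum s F) \<le> (\<Sum>\<^sub>\<infinity>n\<in>UNIV. e n)"
          using part[of F] by (simp add: sum_ennreal[symmetric] s_e s_nonneg)
        then show "sum s F \<le> enn2real (\<Sum>\<^sub>\<infinity>n\<in>UNIV. e n)"
          using enn2real_mono[of "ennreal (sum s F)" "\<Sum>\<^sub>\<infinity>n\<in>UNIV. e n"] fin by (simp add: sum_nonneg s_nonneg)
      qed
    qed (simp add: s_def)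
    fix x :: real
    let ?n = "\<lfloor>x\<rfloor>"
    have "AE y in restrict_space lebesgue {real_of_int ?n<..<real_of_int ?n + 1}. ennreal (cmod (h y)) \<le> e ?n"
      unfolding e_def by (rule esssup_AE)
    then have ae: "AE y in restrict_space lebesgue {real_of_int ?n<..<real_of_int ?n + 1}. cmod (h y) \<le> s ?n"
      by eventually_elim (simp only: s_e[symmetric] ennreal_le_iff[OF s_nonneg])
    show "cmod (h x) \<le> s ?n"
      by (rule continuous_le_AE_bound[OF cont _ ae]) auto
  qed
qed

section \<open>Dilations of the window\<close>

text \<open>
  The factor \<open>A\<close> vanishes near the origin, the only point where the power is singular.
\<close>

lemma continuous_class_C_power:
  assumes "class_C A"
  shows "continuous_on UNIV (\<lambda>x. A x * of_real (\<bar>x\<bar> powr \<gamma>))"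
proof (intro continuous_at_imp_continuous_on ballI)
  fix x :: real
  obtain \<delta> where \<delta>: "\<delta> > 0" "\<And>x. \<bar>x\<bar> < \<delta> \<Longrightarrow> A x = 0" and cont: "continuous_on UNIV A"
    using assms unfolding class_C_def by blast
  show "isCont (\<lambda>x. A x * of_real (\<bar>x\<bar> powr \<gamma>)) x"
  proof (cases "x = 0")
    case True
    have "eventually (\<lambda>x. A x * of_real (\<bar>x\<bar> powr \<gamma>) = 0) (nhds 0)"
      unfolding eventually_nhds_metric using \<delta> by (auto simp: dist_real_def intro!: exI[of _ \<delta>])
    then have "isCont (\<lambda>x. A x * of_real (\<bar>x\<bar> powr \<gamma>)) 0 \<longleftrightarrow> isCont (\<lambda>x. 0 :: complex) (0::real)"
      by (rule isCont_cong)
    then show ?thesis using True by simp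
  next
    case False
    have "isCont A x" using cont by (simp add: continuous_on_eq_continuous_at)
    with False show ?thesis by (intro continuous_intros) auto
  qed
qed

text \<open>
  Outside a compact set \<open>A\<close> is constant on each half-line, so there the product is positively homogeneous of degree
  \<open>\<gamma>\<close>. This is what makes windows outside \<open>L2\<close> tractable: after normalisation by \<open>r powr - \<gamma>\<close>, a dilation
  of this part of the window changes it on a compact set only.
\<close>

lemma class_C_eventually_homogeneous:
  assumes "class_C A"
  obtains \<Delta> where "\<Delta> > 0" "\<And>r x. r \<ge> 1/2 \<Longrightarrow> \<bar>x\<bar> > \<Delta> \<Longrightarrow>
    of_real (r powr - \<gamma>) * (A (r * x) * of_real (\<bar>r * x\<bar> powr \<gamma>)) = A x * of_real (\<bar>x\<bar> powr \<gamma>)"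
proof -
  obtain \<delta> \<Delta> A1 A2 where *: "0 < \<delta>" "\<delta> < \<Delta>"
      "\<And>x. x < - \<Delta> \<Longrightarrow> A x = complex_of_real A1" "\<And>x. x > \<Delta> \<Longrightarrow> A x = complex_of_real A2"
    using assms unfolding class_C_def by blast
  show thesis
  proof
    show "2 * \<Delta> > 0" using * by simp
    fix r x :: real assume r: "r \<ge> 1/2" and x: "\<bar>x\<bar> > 2 * \<Delta>"
    have "A (r * x) = A x"
    proof (cases "x > 0")
      case True
      have "1/2 * x \<le> r * x" using r True by (intro mult_right_mono) auto
      then have "r * x > \<Delta>" "x > \<Delta>" using x True *(1,2) by linarith+
      then show ?thesis by (simp add: *(4))
    next
      case False
      have "r * x \<le> 1/2 * x" using r False by (intro mult_right_mono_neg) auto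
      then have "r * x < - \<Delta>" "x < - \<Delta>" using x False *(1,2) by linarith+
      then show ?thesis by (simp add: *(3))
    qed
    moreover have "r powr - \<gamma> * \<bar>r * x\<bar> powr \<gamma> = \<bar>x\<bar> powr \<gamma>"
      using r by (simp add: abs_mult powr_mult powr_minus)
    then have "complex_of_real (r powr - \<gamma>) * of_real (\<bar>r * x\<bar> powr \<gamma>) = of_real (\<bar>x\<bar> powr \<gamma>)"
      unfolding of_real_mult[symmetric] by simp
    ultimately show "of_real (r powr - \<gamma>) * (A (r * x) * of_real (\<bar>r * x\<bar> powr \<gamma>)) = A x * of_real (\<bar>x\<bar> powr \<gamma>)"
      by (metis mult.left_commute)
  qed
qed

text \<open>
  The difference is supported in \<open>{-R..R}\<close>, and uniform continuity of \<open>(r, x) \<mapsto> r powr - \<gamma> * u (r * x)\<close>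
  on a compact rectangle makes it uniformly small there. Its Wiener norm is therefore small, and so
  is its Bessel bound.
\<close>

lemma gabor_bessel_of_eventually_homogeneous:
  fixes u :: "real \<Rightarrow> complex"
  assumes cont: "continuous_on UNIV u" and pos: "\<alpha> > 0" "\<beta> > 0" "R > 0" "\<eta> > 0"
    and hom: "\<And>r x. 1/2 \<le> r \<Longrightarrow> \<bar>x\<bar> > R \<Longrightarrow> of_real (r powr - \<gamma>) * u (r * x) = u x"
  shows "\<exists>d>0. \<forall>r. \<bar>r - 1\<bar> < d \<longrightarrow>
    gabor_bessel (\<lambda>x. of_real (r powr - \<gamma>) * u (r * x) - u x) \<alpha> \<beta> \<eta>"
proof -
  \<comment> \<open>With this step the support \<open>{-R..R}\<close> meets only the two cells adjacent to the origin.\<close>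
  define L where "L = R + 1"
  define P where "P = nat \<lceil>L * \<beta>\<rceil>"
  have L: "L > 0" and "L * \<beta> > 0" using pos by (auto simp: L_def)
  then have P: "P > 0" "L * \<beta> \<le> real P" unfolding P_def by linarith+
  define C where "C = real P / \<beta> * (L / \<alpha> + 1)"
  have C: "C > 0" using pos P L by (simp add: C_def add_pos_pos)
  define \<tau> where "\<tau> = sqrt (\<eta> / C) / 2"
  have \<tau>: "\<tau> > 0" using pos C by (simp add: \<tau>_def)
  define \<Psi> where "\<Psi> p = of_real (fst p powr - \<gamma>) * u (fst p * snd p)" for p
  define Q where "Q = {1/2..2::real} \<times> {-R..R}"
  have "continuous_on Q \<Psi>"
    unfolding \<Psi>_def[abs_def] Q_def
    by (intro continuous_intros continuous_on_compose2[OF cont]) auto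
  moreover have "compact Q" unfolding Q_def by (intro compact_Times) auto
  ultimately have "uniformly_continuous_on Q \<Psi>" by (rule compact_uniformly_continuous)
  then obtain d where d: "d > 0" "\<And>p q. p \<in> Q \<Longrightarrow> q \<in> Q \<Longrightarrow> dist q p < d \<Longrightarrow> dist (\<Psi> q) (\<Psi> p) < \<tau>"
    unfolding uniformly_continuous_on_def using \<tau> by meson
  have "gabor_bessel (\<lambda>x. of_real (r powr - \<gamma>) * u (r * x) - u x) \<alpha> \<beta> \<eta>"
    if r: "\<bar>r - 1\<bar> < min d (1/2)" for r
  proof -
    define q where "q x = of_real (r powr - \<gamma>) * u (r * x) - u x" for x
    have r_bounds: "1/2 \<le> r" "r \<le> 2" using r unfolding min_less_iff_conj abs_less_iff by linarith+
    define s :: "int \<Rightarrow> real" where "s k = (if k \<in> {-1, 0} then \<tau> else 0)" for k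
    have q_le: "cmod (q x) \<le> (if \<bar>x\<bar> \<le> R then \<tau> else 0)" for x
    proof (cases "\<bar>x\<bar> \<le> R")
      case True
      have "dist (\<Psi> (r, x)) (\<Psi> (1, x)) < \<tau>"
        using True r r_bounds by (intro d(2)) (auto simp: Q_def dist_Pair_Pair dist_real_def)
      then show ?thesis using True by (simp add: \<Psi>_def q_def dist_norm)
    next
      case False
      then show ?thesis using hom[OF r_bounds(1), of x] by (simp add: q_def)
    qed
    have dom: "cmod (q x) \<le> s \<lfloor>x / L\<rfloor>" for x
    proof (cases "\<bar>x\<bar> \<le> R")
      case True
      then have "-1 \<le> x / L" "x / L < 1" using L by (auto simp: L_def field_simps)
      then have "\<lfloor>x / L\<rfloor> \<in> {-1, 0}" by (auto simp: floor_eq_iff)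
      then show ?thesis using q_le[of x] True by (simp add: s_def)
    next
      case False
      then show ?thesis using q_le[of x] \<tau> by (simp add: s_def)
    qed
    have s0: "0 \<le> s k" for k using \<tau> by (simp add: s_def)
    have S: "sum s K \<le> 2 * \<tau>" if "finite K" for K
    proof -
      have "sum s K = (\<Sum>k\<in>K \<inter> {-1, 0}. \<tau>)"
        unfolding s_def sum.inter_restrict[OF that] by (rule refl)
      also have "\<dots> = real (card (K \<inter> {-1, 0})) * \<tau>" by simp
      also have "\<dots> \<le> 2 * \<tau>"
        using \<tau> card_mono[of "{-1, 0::int}" "K \<inter> {-1, 0}"] by (intro mult_right_mono) auto
      finally show ?thesis .
    qed
    have "continuous_on UNIV q"
      unfolding q_def[abs_def] using cont
      by (intro continuous_intros continuous_on_compose2[OF cont]) auto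
    then have "gabor_bessel q \<alpha> \<beta> (C * (2 * \<tau>)\<^sup>2)"
      unfolding C_def using pos(1,2) L P s0 S dom
      by (intro gabor_bessel_amalgam[where s = s] continuous_measurable_lebesgue)
    moreover have "C * (2 * \<tau>)\<^sup>2 = \<eta>" using C pos by (simp add: \<tau>_def)
    ultimately show ?thesis by (simp add: q_def[abs_def])
  qed
  then show ?thesis using d(1) by (intro exI[of _ "min d (1/2)"]) auto
qed

lemma summable_on_small_tail:
  fixes s :: "int \<Rightarrow> real"
  assumes s: "s summable_on UNIV" "\<And>k. 0 \<le> s k" and \<sigma>: "\<sigma> > 0"
  obtains K0 where "finite K0" "\<And>K. finite K \<Longrightarrow> sum s (K - K0) \<le> \<sigma>"
proof -
  obtain K0 where K0: "finite K0" "dist (sum s K0) (infsum s UNIV) \<le> \<sigma>"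
    using infsum_finite_approximation[OF s(1) \<sigma>] by auto
  show thesis
  proof
    fix K :: "int set" assume K: "finite K"
    have "sum s (K - K0) + sum s K0 = sum s ((K - K0) \<union> K0)"
      using K K0 by (subst sum.union_disjoint) auto
    also have "\<dots> \<le> infsum s UNIV"
      using K K0 s by (intro finite_sum_le_infsum) auto
    finally show "sum s (K - K0) \<le> \<sigma>" using K0(2) by (simp add: dist_real_def)
  qed fact
qed

text \<open>
  Far from the origin the suprema bounding \<open>h\<close> have a small sum, so cutting off the central part of
  \<open>h\<close> leaves a window \<open>h'\<close> with small Bessel bound. The same suprema dominate \<open>h' (r * x)\<close> on the grid of step
  \<open>1 / r\<close>, and for \<open>r\<close> bounded below the constants stay bounded; hence one \<open>h'\<close> serves
  all dilations at once.
\<close>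

lemma wiener_W0_small_tail:
  assumes h: "h \<in> wiener_W0" and pos: "\<alpha> > 0" "\<beta> > 0" "\<eta> > 0"
  obtains h' T where "continuous_on UNIV h'" "T > 0" "\<And>x. \<bar>x\<bar> \<ge> T \<Longrightarrow> h' x = h x"
    "\<And>r. 1/2 \<le> r \<Longrightarrow> gabor_bessel (\<lambda>x. h' (r * x)) \<alpha> \<beta> \<eta>"
proof -
  define P where "P = nat \<lceil>2 * \<beta>\<rceil>"
  have P: "P > 0" "2 * \<beta> \<le> real P" using pos unfolding P_def by linarith+
  define C where "C = real P / \<beta> * (2 / \<alpha> + 1)"
  have C: "C > 0" using pos P by (simp add: C_def add_pos_pos)
  define \<sigma> where "\<sigma> = sqrt (\<eta> / C)"
  have \<sigma>: "\<sigma> > 0" using pos C by (simp add: \<sigma>_def)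
  obtain s where s: "\<And>k. 0 \<le> s k" "s summable_on UNIV" "\<And>x. cmod (h x) \<le> s \<lfloor>x\<rfloor>"
    using wiener_W0_pointwise_bound[OF h] by blast
  obtain K0 where K0: "finite K0" "\<And>K. finite K \<Longrightarrow> sum s (K - K0) \<le> \<sigma>"
    using summable_on_small_tail[OF s(2) s(1) \<sigma>] by blast
  define T0 where "T0 = Max (insert 0 (abs ` K0))"
  have T0: "\<bar>k\<bar> \<le> T0" if "k \<in> K0" for k
    unfolding T0_def using K0(1) that by (intro Max_ge) auto
  define T where "T = \<bar>real_of_int T0\<bar> + 1"
  have T: "\<bar>x\<bar> \<le> T" if "\<lfloor>x\<rfloor> \<in> K0" for x
    using T0[OF that] unfolding T_def by linarith
  define cut where "cut x = max 0 (min 1 (T + 1 - \<bar>x\<bar>))" for x :: real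
  define h' where "h' x = of_real (1 - cut x) * h x" for x
  define s' where "s' k = (if k \<in> K0 then 0 else s k)" for k
  have cont: "continuous_on UNIV h'"
    unfolding h'_def[abs_def] cut_def using h by (intro continuous_intros) (auto simp: wiener_W0_def)
  have h'_le: "cmod (h' x) \<le> s' \<lfloor>x\<rfloor>" for x
  proof (cases "\<lfloor>x\<rfloor> \<in> K0")
    case True
    then show ?thesis using T[OF True] by (simp add: h'_def cut_def s'_def)
  next
    case False
    have "\<bar>1 - cut x\<bar> \<le> 1" by (auto simp: cut_def)
    then have "cmod (h' x) \<le> 1 * cmod (h x)" unfolding h'_def norm_mult
      by (intro mult_right_mono) (auto simp del: of_real_diff)
    then show ?thesis using s(3)[of x] False by (simp add: s'_def)
  qed
  have S: "sum s' K \<le> \<sigma>" if "finite K" for K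
  proof -
    have "sum s' K = sum s (K - K0)" using that
      unfolding s'_def by (simp add: sum.If_cases Diff_eq)
    then show ?thesis using K0(2)[OF that] by simp
  qed
  show thesis
  proof
    show "continuous_on UNIV h'" by fact
    show "T + 1 > 0" by (simp add: T_def)
    show "h' x = h x" if "\<bar>x\<bar> \<ge> T + 1" for x using that by (simp add: h'_def cut_def)
    fix r :: real assume r: "1/2 \<le> r"
    have "continuous_on UNIV (\<lambda>x. h' (r * x))"
      by (intro continuous_intros continuous_on_compose2[OF cont]) auto
    moreover have "(1 / r) * \<beta> \<le> 2 * \<beta>"
      using r pos by (intro mult_right_mono) (auto simp: field_simps)
    then have "(1 / r) * \<beta> \<le> real P" using P by linarith
    moreover have "cmod (h' (r * x)) \<le> s' \<lfloor>x / (1 / r)\<rfloor>" for x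
      using h'_le[of "r * x"] by (simp add: mult.commute)
    ultimately have "gabor_bessel (\<lambda>x. h' (r * x)) \<alpha> \<beta> (real P / \<beta> * ((1 / r) / \<alpha> + 1) * \<sigma>\<^sup>2)"
      using pos r P(1) S
      by (intro gabor_bessel_amalgam[where s = s'] continuous_measurable_lebesgue) (auto simp: s'_def s(1))
    moreover have "real P / \<beta> * ((1 / r) / \<alpha> + 1) * \<sigma>\<^sup>2 \<le> C * \<sigma>\<^sup>2"
      unfolding C_def using pos r
      by (intro mult_right_mono mult_left_mono add_right_mono divide_right_mono) (auto simp: field_simps)
    moreover have "C * \<sigma>\<^sup>2 = \<eta>" using C pos by (simp add: \<sigma>_def)
    ultimately show "gabor_bessel (\<lambda>x. h' (r * x)) \<alpha> \<beta> \<eta>"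
      by (metis gabor_bessel_mono)
  qed
qed

text \<open>
  The window is split as \<open>g = u + h'\<close>, where \<open>h'\<close> is a tail of \<open>h\<close>. The part \<open>u\<close> agrees with
  \<open>A x * \<bar>x\<bar> powr \<gamma>\<close> far out, so its rescaling is a small perturbation. The
  tail is small both before and after dilation, and no cancellation between the two is used.
\<close>

lemma gabor_bessel_rescaled_window_difference:
  assumes A: "class_C A" and h: "h \<in> wiener_W0"
    and g: "\<And>x. g x = A x * of_real (\<bar>x\<bar> powr \<gamma>) + h x"
    and pos: "\<alpha> > 0" "\<beta> > 0" "\<eta> > 0"
  shows "\<exists>d>0. \<forall>r. \<bar>r - 1\<bar> < d \<longrightarrow>
    gabor_bessel (\<lambda>x. of_real (r powr - \<gamma>) * g (r * x) - g x) \<alpha> \<beta> \<eta>"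
proof -
  define Q where "Q = 2 powr \<bar>\<gamma>\<bar>"
  have Q: "Q > 0" by (simp add: Q_def)
  \<comment> \<open>Chosen so that the two tails together contribute at most \<open>\<eta> / 2\<close>.\<close>
  define \<eta>' where "\<eta>' = \<eta> / (8 * (Q\<^sup>2 + 1))"
  have \<eta>': "\<eta>' > 0" using pos by (simp add: \<eta>'_def add_nonneg_pos)
  obtain h' T where h': "continuous_on UNIV h'" "T > 0" "\<And>x. \<bar>x\<bar> \<ge> T \<Longrightarrow> h' x = h x"
    "\<And>r. 1/2 \<le> r \<Longrightarrow> gabor_bessel (\<lambda>x. h' (r * x)) \<alpha> \<beta> \<eta>'"
    using wiener_W0_small_tail[OF h pos(1,2) \<eta>'] by blast
  obtain \<Delta> where \<Delta>: "\<Delta> > 0" "\<And>r x. r \<ge> 1/2 \<Longrightarrow> \<bar>x\<bar> > \<Delta> \<Longrightarrow>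
    of_real (r powr - \<gamma>) * (A (r * x) * of_real (\<bar>r * x\<bar> powr \<gamma>)) = A x * of_real (\<bar>x\<bar> powr \<gamma>)"
    using class_C_eventually_homogeneous[OF A] by blast
  define u where "u x = g x - h' x" for x
  have cont_u: "continuous_on UNIV u"
    unfolding u_def[abs_def] g
    by (intro continuous_on_diff continuous_on_add continuous_class_C_power[OF A] h'(1))
       (use h in \<open>auto simp: wiener_W0_def\<close>)
  have hom: "of_real (r powr - \<gamma>) * u (r * x) = u x" if r: "1/2 \<le> r" and x: "\<bar>x\<bar> > max \<Delta> (2 * T)" for r x
  proof -
    have "T \<le> 1/2 * \<bar>x\<bar>" using x by auto
    also have "\<dots> \<le> r * \<bar>x\<bar>" using r by (intro mult_right_mono) auto
    finally have "T \<le> \<bar>r * x\<bar>" using r by (simp add: abs_mult)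
    moreover have "T \<le> \<bar>x\<bar>" using x h'(2) by auto
    ultimately show ?thesis using \<Delta>(2)[OF r, of x] x by (simp add: u_def g h'(3))
  qed
  have "\<exists>d>0. \<forall>r. \<bar>r - 1\<bar> < d \<longrightarrow>
      gabor_bessel (\<lambda>x. of_real (r powr - \<gamma>) * u (r * x) - u x) \<alpha> \<beta> (\<eta> / 4)"
    using cont_u pos(1,2) _ _ hom
    by (rule gabor_bessel_of_eventually_homogeneous[where R = "max \<Delta> (2 * T)"]) (use \<Delta>(1) pos(3) in auto)
  then obtain d where d: "d > 0" "\<And>r. \<bar>r - 1\<bar> < d \<Longrightarrow>
      gabor_bessel (\<lambda>x. of_real (r powr - \<gamma>) * u (r * x) - u x) \<alpha> \<beta> (\<eta> / 4)"
    by blast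
  have "gabor_bessel (\<lambda>x. of_real (r powr - \<gamma>) * g (r * x) - g x) \<alpha> \<beta> \<eta>"
    if r: "\<bar>r - 1\<bar> < min d (1/2)" for r
  proof -
    have r_bounds: "1/2 \<le> r" "r \<le> 2" using r unfolding min_less_iff_conj abs_less_iff by linarith+
    define c where "c = r powr - \<gamma>"
    have c: "0 \<le> c" "c \<le> Q"
    proof -
      have "\<bar>ln r\<bar> \<le> ln 2"
        using r_bounds ln_mono[of r 2] ln_mono[of "1/2" r] by (auto simp: ln_div abs_le_iff)
      then have "\<bar>\<gamma>\<bar> * \<bar>ln r\<bar> \<le> \<bar>\<gamma>\<bar> * ln 2" by (intro mult_left_mono) auto
      then have "- \<gamma> * ln r \<le> \<bar>\<gamma>\<bar> * ln 2"
        using abs_ge_minus_self[of "\<gamma> * ln r"] by (simp add: abs_mult)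
      then show "c \<le> Q" using r_bounds by (simp add: c_def Q_def powr_def)
    qed (simp add: c_def)
    have "gabor_bessel (\<lambda>x. of_real c * h' (r * x) + (-1) * h' (1 * x)) \<alpha> \<beta>
       (2 * ((cmod (of_real c))\<^sup>2 * \<eta>') + 2 * ((cmod (-1))\<^sup>2 * \<eta>'))"
      by (intro gabor_bessel_add gabor_bessel_scale h'(4)) (use r_bounds in auto)
    moreover have "2 * ((cmod (of_real c))\<^sup>2 * \<eta>') + 2 * ((cmod (-1))\<^sup>2 * \<eta>') \<le> \<eta> / 4"
    proof -
      have "c\<^sup>2 \<le> Q\<^sup>2" using c by (intro power_mono) auto
      then have "2 * (c\<^sup>2 * \<eta>') + 2 * \<eta>' \<le> 2 * (Q\<^sup>2 * \<eta>') + 2 * \<eta>'" using \<eta>' by simp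
      also have "\<dots> = 2 * (Q\<^sup>2 + 1) * \<eta>'" by (simp add: algebra_simps)
      also have "\<dots> = \<eta> / 4"
        using add_nonneg_pos[of "Q\<^sup>2" 1] by (simp add: \<eta>'_def field_simps)
      finally show ?thesis by simp
    qed
    ultimately have "gabor_bessel (\<lambda>x. of_real c * h' (r * x) + (-1) * h' (1 * x)) \<alpha> \<beta> (\<eta> / 4)"
      by (rule gabor_bessel_mono)
    with d(2)[of r] r have "gabor_bessel (\<lambda>x. (of_real (r powr - \<gamma>) * u (r * x) - u x) +
        (of_real c * h' (r * x) + (-1) * h' (1 * x))) \<alpha> \<beta> (2 * (\<eta> / 4) + 2 * (\<eta> / 4))"
      by (intro gabor_bessel_add) auto
    then show ?thesis by (simp add: u_def c_def algebra_simps)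
  qed
  then show ?thesis using d(1) by (intro exI[of _ "min d (1/2)"]) auto
qed

section \<open>Growth of the window\<close>

lemma continuous_window:
  assumes "class_C A" "h \<in> wiener_W0"
    and g: "\<And>x. g x = A x * of_real (\<bar>x\<bar> powr \<gamma>) + h x"
  shows "continuous_on UNIV g"
  unfolding g using assms
  by (intro continuous_on_add continuous_class_C_power) (auto simp: wiener_W0_def)

text \<open>
  Ensures that the inner products with Schwartz functions converge absolutely, also
  when the window is not square integrable.
\<close>

lemma window_polynomial_growth:
  assumes A: "class_C A" and h: "h \<in> wiener_W0"
    and g: "\<And>x. g x = A x * of_real (\<bar>x\<bar> powr \<gamma>) + h x"
  shows "\<exists>D j. \<forall>x. cmod (g x) \<le> D * (1 + \<bar>x\<bar>) ^ j"
proof -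
  define j where "j = nat \<lceil>\<gamma>\<rceil>"
  obtain \<delta> \<Delta> A1 A2 where *: "0 < \<delta>" "\<delta> < \<Delta>"
      "\<And>x. x < - \<Delta> \<Longrightarrow> A x = complex_of_real A1" "\<And>x. x > \<Delta> \<Longrightarrow> A x = complex_of_real A2"
    using A unfolding class_C_def by blast
  obtain s where s: "\<And>k. 0 \<le> s k" "s summable_on UNIV" "\<And>x. cmod (h x) \<le> s \<lfloor>x\<rfloor>"
    using wiener_W0_pointwise_bound[OF h] by blast
  have h_le: "cmod (h x) \<le> infsum s UNIV" for x
    using s(3)[of x] finite_sum_le_infsum[OF s(2), of "{\<lfloor>x\<rfloor>}"] s(1) by (auto intro: order_trans)
  let ?p = "\<lambda>x. A x * of_real (\<bar>x\<bar> powr \<gamma>)"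
  have "compact (?p ` {- (\<Delta> + 1)..\<Delta> + 1})"
    by (intro compact_continuous_image continuous_on_subset[OF continuous_class_C_power[OF A]]) auto
  then obtain E where "\<forall>y\<in>?p ` {- (\<Delta> + 1)..\<Delta> + 1}. cmod y \<le> E"
    using compact_imp_bounded bounded_iff by blast
  then have E: "cmod (?p x) \<le> E" if "\<bar>x\<bar> \<le> \<Delta> + 1" for x
    using that by (auto simp: abs_le_iff)
  have E0: "E \<ge> 0" using order_trans[OF norm_ge_zero E[of 0]] *(1,2) by simp
  have p_le: "cmod (?p x) \<le> (E + \<bar>A1\<bar> + \<bar>A2\<bar>) * (1 + \<bar>x\<bar>) ^ j" for x
  proof (cases "\<bar>x\<bar> \<le> \<Delta> + 1")
    case True
    have "cmod (?p x) \<le> (E + \<bar>A1\<bar> + \<bar>A2\<bar>) * 1" using E[OF True] by simp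
    also have "\<dots> \<le> (E + \<bar>A1\<bar> + \<bar>A2\<bar>) * (1 + \<bar>x\<bar>) ^ j"
      using E0 by (intro mult_left_mono one_le_power) auto
    finally show ?thesis .
  next
    case False
    then have x: "x < - \<Delta> \<or> x > \<Delta>" "1 \<le> \<bar>x\<bar>" using *(1,2) by linarith+
    have "\<bar>x\<bar> powr \<gamma> \<le> \<bar>x\<bar> powr real j"
      using x(2) by (intro powr_mono) (auto simp: j_def, linarith)
    also have "\<dots> = \<bar>x\<bar> ^ j" using x(2) by (simp add: powr_realpow)
    also have "\<dots> \<le> (1 + \<bar>x\<bar>) ^ j" by (intro power_mono) auto
    finally have "\<bar>x\<bar> powr \<gamma> \<le> (1 + \<bar>x\<bar>) ^ j" .
    moreover have "cmod (A x) \<le> E + \<bar>A1\<bar> + \<bar>A2\<bar>" using x(1) *(3,4) E0 by auto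
    ultimately show ?thesis unfolding norm_mult using E0 by (intro mult_mono) auto
  qed
  have "cmod (g x) \<le> (E + \<bar>A1\<bar> + \<bar>A2\<bar> + infsum s UNIV) * (1 + \<bar>x\<bar>) ^ j" for x
  proof -
    have "cmod (h x) \<le> infsum s UNIV * 1" using h_le by simp
    also have "\<dots> \<le> infsum s UNIV * (1 + \<bar>x\<bar>) ^ j"
      using s(1) by (intro mult_left_mono one_le_power infsum_nonneg) auto
    finally show ?thesis
      using p_le[of x] norm_triangle_ineq[of "?p x" "h x"] by (simp add: g distrib_right)
  qed
  then show ?thesis by blast
qed

lemma integrable_schwartz_times_atom:
  assumes f: "f \<in> schwartz" and w: "continuous_on UNIV w"
    and grow: "\<And>x. cmod (w x) \<le> D * (1 + \<bar>x\<bar>) ^ j"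
  shows "integrable lebesgue (\<lambda>x. f x * cnj (gabor_atom w \<alpha> \<beta> n m x))"
proof (rule integrable_schwartz_times_polynomial_growth[OF f])
  show "(\<lambda>x. cnj (gabor_atom w \<alpha> \<beta> n m x)) \<in> borel_measurable lebesgue"
    by (intro borel_measurable_cnj gabor_atom_measurable continuous_measurable_lebesgue w)
  fix x
  let ?b = "of_int n * \<alpha>"
  have D: "D \<ge> 0" using order_trans[OF norm_ge_zero grow[of 0]] by simp
  have "cmod (cnj (gabor_atom w \<alpha> \<beta> n m x)) = cmod (w (x - ?b))"
    by (simp add: gabor_atom_def norm_mult)
  also have "\<dots> \<le> D * (1 + \<bar>x - ?b\<bar>) ^ j" by (rule grow)
  also have "\<dots> \<le> D * ((1 + \<bar>?b\<bar>) * (1 + \<bar>x\<bar>)) ^ j"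
  proof (intro mult_left_mono power_mono)
    have "0 \<le> \<bar>?b\<bar> * \<bar>x\<bar>" by simp
    then show "1 + \<bar>x - ?b\<bar> \<le> (1 + \<bar>?b\<bar>) * (1 + \<bar>x\<bar>)"
      using abs_triangle_ineq4[of x ?b] unfolding distrib_left distrib_right by linarith
  qed (use D in auto)
  also have "\<dots> = (D * (1 + \<bar>?b\<bar>) ^ j) * (1 + \<bar>x\<bar>) ^ j" by (simp add: power_mult_distrib)
  finally show "cmod (cnj (gabor_atom w \<alpha> \<beta> n m x)) \<le> (D * (1 + \<bar>?b\<bar>) ^ j) * (1 + \<bar>x\<bar>) ^ j" .
qed

section \<open>Frames under dilation and perturbation\<close>

text \<open>
  The substitution \<open>x = r * y\<close>. Both lattices have the same product of parameters, which is why the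
  modulations match.
\<close>

lemma L2_inner_gabor_atom_dilation:
  assumes r: "r > 0" and \<alpha>: "\<alpha> = r * \<alpha>0" and \<beta>: "\<beta>0 = r * \<beta>"
  shows "L2_inner f (gabor_atom g \<alpha> \<beta> n m)
    = of_real r * L2_inner (\<lambda>x. f (r * x)) (gabor_atom (\<lambda>x. g (r * x)) \<alpha>0 \<beta>0 n m)"
  unfolding L2_inner_def
  by (subst lebesgue_integral_real_affine[of r _ 0])
     (use r in \<open>simp_all add: gabor_atom_def \<alpha> \<beta> scaleR_conv_of_real right_diff_distrib mult_ac\<close>)

lemma L2_norm_dilation:
  assumes r: "r > 0"
  shows "(L2_norm f)\<^sup>2 = r * (L2_norm (\<lambda>x. f (r * x)))\<^sup>2"
  unfolding L2_norm_square
  by (subst lebesgue_integral_real_affine[of r _ 0]) (use r in simp_all)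

lemma sum_le_infsum_ennreal:
  fixes f :: "'a \<Rightarrow> ennreal"
  assumes "finite X"
  shows "sum f X \<le> infsum f UNIV"
  using assms by (subst nonneg_infsum_complete) (auto intro: SUP_upper)

lemma infsum_le_ennreal:
  fixes f :: "'a \<Rightarrow> ennreal"
  assumes "\<And>X. finite X \<Longrightarrow> sum f X \<le> c"
  shows "infsum f UNIV \<le> c"
  using assms by (subst nonneg_infsum_complete) (auto intro: SUP_least)

text \<open>
  Here \<open>a\<close> are the coefficients for the unperturbed window and \<open>e\<close> those for the perturbation;
  the new coefficients \<open>b\<close> are \<open>a + e\<close> up to the factor that a dilation produces. Since \<open>\<bar>a\<bar>\<^sup>2 \<le> 2 \<bar>a + e\<bar>\<^sup>2 + 2 \<bar>e\<bar>\<^sup>2\<close>, a perturbation with Bessel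
  bound \<open>A' / 4\<close> consumes at most half of the lower frame bound.
\<close>

lemma frame_inequality_perturbation:
  fixes a b e :: "'i \<Rightarrow> complex" and A' B' N \<rho> :: real
  assumes pos: "A' > 0" "B' > 0" "\<rho> > 0" "N \<ge> 0"
    and lower: "ennreal (A' * N) \<le> (\<Sum>\<^sub>\<infinity>i. ennreal ((cmod (a i))\<^sup>2))"
    and upper: "(\<Sum>\<^sub>\<infinity>i. ennreal ((cmod (a i))\<^sup>2)) \<le> ennreal (B' * N)"
    and e: "\<And>X. finite X \<Longrightarrow> (\<Sum>i\<in>X. (cmod (e i))\<^sup>2) \<le> A' / 4 * N"
    and b: "\<And>i. (cmod (b i))\<^sup>2 = \<rho> * (cmod (a i + e i))\<^sup>2"
  shows "ennreal (\<rho> * A' / 4 * N) \<le> (\<Sum>\<^sub>\<infinity>i. ennreal ((cmod (b i))\<^sup>2))" (is ?lower)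
    and "(\<Sum>\<^sub>\<infinity>i. ennreal ((cmod (b i))\<^sup>2)) \<le> ennreal (\<rho> * (2 * B' + A' / 2) * N)" (is ?upper)
proof -
  have fin_a: "(\<Sum>i\<in>X. (cmod (a i))\<^sup>2) \<le> B' * N" if "finite X" for X
  proof -
    have "ennreal (\<Sum>i\<in>X. (cmod (a i))\<^sup>2) \<le> ennreal (B' * N)"
      using order_trans[OF sum_le_infsum_ennreal[OF that] upper] by (simp add: sum_ennreal)
    then show ?thesis using pos by (simp add: ennreal_le_iff)
  qed
  show ?upper
  proof (rule infsum_le_ennreal)
    fix X :: "'i set" assume X: "finite X"
    have "(\<Sum>i\<in>X. (cmod (b i))\<^sup>2) \<le> (\<Sum>i\<in>X. \<rho> * (2 * (cmod (a i))\<^sup>2 + 2 * (cmod (e i))\<^sup>2))"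
      unfolding b using pos by (intro sum_mono mult_left_mono norm_add_square_le) auto
    also have "\<dots> = \<rho> * (2 * (\<Sum>i\<in>X. (cmod (a i))\<^sup>2) + 2 * (\<Sum>i\<in>X. (cmod (e i))\<^sup>2))"
      by (simp add: sum.distrib sum_distrib_left distrib_left)
    also have "\<dots> \<le> \<rho> * (2 * (B' * N) + 2 * (A' / 4 * N))"
      using pos by (intro mult_left_mono add_mono fin_a e X) auto
    also have "\<dots> = \<rho> * (2 * B' + A' / 2) * N" by (simp add: algebra_simps)
    finally show "(\<Sum>i\<in>X. ennreal ((cmod (b i))\<^sup>2)) \<le> ennreal (\<rho> * (2 * B' + A' / 2) * N)"
      by (simp add: sum_ennreal ennreal_leI)
  qed
  then obtain I where I: "I \<ge> 0" "(\<Sum>\<^sub>\<infinity>i. ennreal ((cmod (b i))\<^sup>2)) = ennreal I"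
    by (cases "\<Sum>\<^sub>\<infinity>i. ennreal ((cmod (b i))\<^sup>2)") (auto simp: top_unique)
  have "(\<Sum>\<^sub>\<infinity>i. ennreal ((cmod (a i))\<^sup>2)) \<le> ennreal (2 / \<rho> * I + A' / 2 * N)"
  proof (rule infsum_le_ennreal)
    fix X :: "'i set" assume X: "finite X"
    have fin_b: "(\<Sum>i\<in>X. (cmod (b i))\<^sup>2) \<le> I"
      using sum_le_infsum_ennreal[OF X, of "\<lambda>i. ennreal ((cmod (b i))\<^sup>2)"] I
      by (simp add: sum_ennreal ennreal_le_iff)
    have "(cmod (a i))\<^sup>2 \<le> 2 / \<rho> * (cmod (b i))\<^sup>2 + 2 * (cmod (e i))\<^sup>2" for i
      using norm_add_square_le[of "a i + e i" "- e i"] pos by (simp add: b)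
    then have "(\<Sum>i\<in>X. (cmod (a i))\<^sup>2) \<le> (\<Sum>i\<in>X. 2 / \<rho> * (cmod (b i))\<^sup>2 + 2 * (cmod (e i))\<^sup>2)"
      by (intro sum_mono)
    also have "\<dots> = 2 / \<rho> * (\<Sum>i\<in>X. (cmod (b i))\<^sup>2) + 2 * (\<Sum>i\<in>X. (cmod (e i))\<^sup>2)"
      by (simp add: sum.distrib sum_distrib_left)
    also have "\<dots> \<le> 2 / \<rho> * I + 2 * (A' / 4 * N)"
      using pos by (intro add_mono mult_left_mono fin_b e X) auto
    finally show "(\<Sum>i\<in>X. ennreal ((cmod (a i))\<^sup>2)) \<le> ennreal (2 / \<rho> * I + A' / 2 * N)"
      by (simp add: sum_ennreal ennreal_leI)
  qed
  with lower have "ennreal (A' * N) \<le> ennreal (2 / \<rho> * I + A' / 2 * N)" by (rule order_trans)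
  then have "A' * N \<le> 2 / \<rho> * I + A' / 2 * N"
    using pos I(1) by (subst (asm) ennreal_le_iff) auto
  moreover have "A' * N = A' / 2 * N + A' / 2 * N" by simp
  ultimately have "A' / 2 * N \<le> 2 / \<rho> * I" by linarith
  then have "\<rho> / 2 * (A' / 2 * N) \<le> \<rho> / 2 * (2 / \<rho> * I)" using pos by (intro mult_left_mono) auto
  then have "\<rho> * A' / 4 * N \<le> I" using pos by simp
  then show ?lower unfolding I by (rule ennreal_leI)
qed

theorem theorem1p1:
  fixes A h g :: "real \<Rightarrow> complex" and \<gamma> c :: real
  assumes "class_C A"
    and "h \<in> wiener_W0"
    and "\<And>x. g x = A x * of_real (\<bar>x\<bar> powr \<gamma>) + h x"
    and "c > 0"
  shows "open {\<alpha>::real. \<alpha> > 0 \<and> (\<alpha>, c / \<alpha>) \<in> frame_set g}"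
proof -
  define F where "F = (if g \<in> L2 then L2 else schwartz)"
  have cont: "continuous_on UNIV g" by (rule continuous_window[OF assms(1-3)])
  obtain D j where grow: "\<And>x. cmod (g x) \<le> D * (1 + \<bar>x\<bar>) ^ j"
    using window_polynomial_growth[OF assms(1-3)] by blast
  have F_L2: "F \<subseteq> L2" using schwartz_subset_L2 by (simp add: F_def)
  have F_dil: "(\<lambda>x. f (r * x)) \<in> F" if "f \<in> F" "r > 0" for f r
    using that schwartz_dilation[of f r] L2_affine[of r f 0] by (auto simp: F_def split: if_splits)
  have int_g: "integrable lebesgue (\<lambda>x. f x * cnj (gabor_atom g \<alpha> \<beta> n m x))" if "f \<in> F" for f \<alpha> \<beta> n m
  proof (cases "g \<in> L2")
    case True
    then show ?thesis using that by (intro L2_mult_integrable gabor_atom_in_L2) (auto simp: F_def)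
  next
    case False
    then show ?thesis using that by (intro integrable_schwartz_times_atom[OF _ cont grow]) (auto simp: F_def)
  qed
  have nbhd: "\<exists>e>0. \<forall>\<alpha>. \<bar>\<alpha> - \<alpha>0\<bar> < e \<longrightarrow> \<alpha> > 0 \<and> frame_bounds_on F g \<alpha> (c / \<alpha>)"
    if \<alpha>0: "\<alpha>0 > 0" and frame: "frame_bounds_on F g \<alpha>0 (c / \<alpha>0)" for \<alpha>0
  proof -
    define \<beta>0 where "\<beta>0 = c / \<alpha>0"
    have \<beta>0: "\<beta>0 > 0" using \<alpha>0 assms(4) by (simp add: \<beta>0_def)
    obtain A' B' where AB: "A' > 0" "B' > 0"
      and lower: "\<And>f. f \<in> F \<Longrightarrow> ennreal (A' * (L2_norm f)\<^sup>2)
         \<le> (\<Sum>\<^sub>\<infinity>(n, m)\<in>UNIV. ennreal ((cmod (L2_inner f (gabor_atom g \<alpha>0 \<beta>0 n m)))\<^sup>2))"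
      and upper: "\<And>f. f \<in> F \<Longrightarrow> (\<Sum>\<^sub>\<infinity>(n, m)\<in>UNIV. ennreal ((cmod (L2_inner f (gabor_atom g \<alpha>0 \<beta>0 n m)))\<^sup>2))
         \<le> ennreal (B' * (L2_norm f)\<^sup>2)"
      using frame unfolding frame_bounds_on_def \<beta>0_def by blast
    obtain d where d: "d > 0" "\<And>r. \<bar>r - 1\<bar> < d \<Longrightarrow>
        gabor_bessel (\<lambda>x. of_real (r powr - \<gamma>) * g (r * x) - g x) \<alpha>0 \<beta>0 (A' / 4)"
      using gabor_bessel_rescaled_window_difference[OF assms(1-3) \<alpha>0 \<beta>0, of "A' / 4"] AB by auto
    \<comment> \<open>The bound by \<open>\<alpha>0 * d\<close> says that the dilation factor is within \<open>d\<close> of 1, the bound by \<open>\<alpha>0\<close>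
      that it is positive.\<close>
    have "\<alpha> > 0 \<and> frame_bounds_on F g \<alpha> (c / \<alpha>)" if close: "\<bar>\<alpha> - \<alpha>0\<bar> < \<alpha>0 * min d 1" for \<alpha>
    proof -
      define r where "r = \<alpha> / \<alpha>0"
      have "\<bar>r - 1\<bar> = \<bar>\<alpha> - \<alpha>0\<bar> / \<alpha>0" using \<alpha>0 by (simp add: r_def diff_divide_distrib[symmetric] field_simps)
      then have r1: "\<bar>r - 1\<bar> < min d 1" using close \<alpha>0 by (simp add: pos_divide_less_eq mult.commute del: min_less_iff_conj)
      then have r: "r > 0" "\<bar>r - 1\<bar> < d" by (auto simp: abs_less_iff)
      have \<alpha>_eq: "\<alpha> = r * \<alpha>0" using \<alpha>0 by (simp add: r_def)
      then have "\<alpha> > 0" using r \<alpha>0 by simp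
      have \<beta>_eq: "\<beta>0 = r * (c / \<alpha>)" using r \<alpha>0 by (simp add: \<alpha>_eq \<beta>0_def)
      define \<epsilon> where "\<epsilon> x = of_real (r powr - \<gamma>) * g (r * x) - g x" for x
      have \<epsilon>: "gabor_bessel \<epsilon> \<alpha>0 \<beta>0 (A' / 4)"
        using d(2)[OF r(2)] by (simp add: \<epsilon>_def[abs_def])
      have g_r: "g (r * x) = of_real (r powr \<gamma>) * (g x + \<epsilon> x)" for x
      proof -
        have "of_real (r powr \<gamma>) * (g x + \<epsilon> x) = of_real (r powr \<gamma> * r powr - \<gamma>) * g (r * x)"
          by (simp add: \<epsilon>_def)
        also have "r powr \<gamma> * r powr - \<gamma> = 1" using r by (simp add: powr_add[symmetric])
        finally show ?thesis by simp
      qed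
      define \<rho> where "\<rho> = (r * r powr \<gamma>)\<^sup>2"
      have \<rho>: "\<rho> > 0" using r by (simp add: \<rho>_def)
      have inner: "L2_inner f (gabor_atom g \<alpha> (c / \<alpha>) n m) = of_real (r * r powr \<gamma>) *
          (L2_inner (\<lambda>x. f (r * x)) (gabor_atom g \<alpha>0 \<beta>0 n m) + L2_inner (\<lambda>x. f (r * x)) (gabor_atom \<epsilon> \<alpha>0 \<beta>0 n m))"
        if f: "f \<in> F" for f n m
      proof -
        let ?f = "\<lambda>x. f (r * x)"
        have fr: "?f \<in> F" using F_dil[OF f r(1)] .
        have i\<epsilon>: "integrable lebesgue (\<lambda>x. ?f x * cnj (gabor_atom \<epsilon> \<alpha>0 \<beta>0 n m x))"
          using fr F_L2 \<epsilon> by (intro L2_mult_integrable gabor_atom_in_L2) (auto simp: gabor_bessel_def)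
        have "?f x * cnj (gabor_atom (\<lambda>x. g (r * x)) \<alpha>0 \<beta>0 n m x)
          = of_real (r powr \<gamma>) * (?f x * cnj (gabor_atom g \<alpha>0 \<beta>0 n m x) + ?f x * cnj (gabor_atom \<epsilon> \<alpha>0 \<beta>0 n m x))" for x
          unfolding gabor_atom_def g_r by (simp add: distrib_left distrib_right mult_ac)
        then have "L2_inner ?f (gabor_atom (\<lambda>x. g (r * x)) \<alpha>0 \<beta>0 n m)
          = of_real (r powr \<gamma>) * (L2_inner ?f (gabor_atom g \<alpha>0 \<beta>0 n m) + L2_inner ?f (gabor_atom \<epsilon> \<alpha>0 \<beta>0 n m))"
          unfolding L2_inner_def
          by (simp only: integral_mult_right_zero Bochner_Integration.integral_add[OF int_g[OF fr] i\<epsilon>])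
        then show ?thesis
          unfolding L2_inner_gabor_atom_dilation[OF r(1) \<alpha>_eq \<beta>_eq] by simp
      qed
      have "frame_bounds_on F g \<alpha> (c / \<alpha>)"
        unfolding frame_bounds_on_def
      proof (intro exI conjI ballI)
        show "\<rho> * A' / 4 / r > 0" "\<rho> * (2 * B' + A' / 2) / r > 0" using \<rho> AB r by auto
        fix f assume f: "f \<in> F"
        let ?f = "\<lambda>x. f (r * x)"
        have fr: "?f \<in> F" using F_dil[OF f r(1)] .
        define a where "a p = L2_inner ?f (gabor_atom g \<alpha>0 \<beta>0 (fst p) (snd p))" for p
        define e where "e p = L2_inner ?f (gabor_atom \<epsilon> \<alpha>0 \<beta>0 (fst p) (snd p))" for p
        define b where "b p = L2_inner f (gabor_atom g \<alpha> (c / \<alpha>) (fst p) (snd p))" for p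
        have "(\<Sum>p\<in>X. (cmod (e p))\<^sup>2) \<le> A' / 4 * (L2_norm ?f)\<^sup>2" if "finite X" for X
          using \<epsilon> fr F_L2 that by (auto simp: gabor_bessel_def e_def case_prod_unfold)
        moreover have "(cmod (b p))\<^sup>2 = \<rho> * (cmod (a p + e p))\<^sup>2" for p
          unfolding b_def inner[OF f] \<rho>_def a_def e_def by (simp add: norm_mult power_mult_distrib)
        ultimately have *: "ennreal (\<rho> * A' / 4 * (L2_norm ?f)\<^sup>2) \<le> (\<Sum>\<^sub>\<infinity>p. ennreal ((cmod (b p))\<^sup>2))"
          "(\<Sum>\<^sub>\<infinity>p. ennreal ((cmod (b p))\<^sup>2)) \<le> ennreal (\<rho> * (2 * B' + A' / 2) * (L2_norm ?f)\<^sup>2)"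
          using frame_inequality_perturbation[of A' B' \<rho> "(L2_norm ?f)\<^sup>2" a e b] AB \<rho> lower[OF fr] upper[OF fr]
          by (auto simp: a_def case_prod_unfold)
        have norm: "k * (L2_norm ?f)\<^sup>2 = k / r * (L2_norm f)\<^sup>2" for k
          using L2_norm_dilation[OF r(1), of f] r by simp
        show "ennreal (\<rho> * A' / 4 / r * (L2_norm f)\<^sup>2)
            \<le> (\<Sum>\<^sub>\<infinity>(n, m)\<in>UNIV. ennreal ((cmod (L2_inner f (gabor_atom g \<alpha> (c / \<alpha>) n m)))\<^sup>2))"
          "(\<Sum>\<^sub>\<infinity>(n, m)\<in>UNIV. ennreal ((cmod (L2_inner f (gabor_atom g \<alpha> (c / \<alpha>) n m)))\<^sup>2))
            \<le> ennreal (\<rho> * (2 * B' + A' / 2) / r * (L2_norm f)\<^sup>2)"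
          using * unfolding norm by (simp_all add: b_def case_prod_unfold)
      qed
      with \<open>\<alpha> > 0\<close> show ?thesis by blast
    qed
    moreover have "\<alpha>0 * min d 1 > 0" using \<alpha>0 d(1) by simp
    ultimately show ?thesis by blast
  qed
  have set_eq: "{\<alpha>::real. \<alpha> > 0 \<and> (\<alpha>, c / \<alpha>) \<in> frame_set g} = {\<alpha>. \<alpha> > 0 \<and> frame_bounds_on F g \<alpha> (c / \<alpha>)}"
    using assms(4) by (auto simp: frame_set_def gabor_frame_def F_def)
  show ?thesis
    unfolding set_eq open_dist using nbhd by (auto simp: dist_real_def)
qed

end
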